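(* Let $f$ be an interval map satisfying Young's hypotheses (described in the context), with constants $B=\Vert f'\Vert_\infty>1$, $\alpha\in(0,1)$ and $\theta>0$, and let $\Phi$ be the density of its absolutely continuous (SRB) invariant probability measure $\mu$. For any positive $$\tau<\min\left\{\frac{\log\alpha^{-1}}{2\log B},\ \frac14\Big(\min\{1,\theta/\log B\}\Big)^3\right\}$$ there exists $C>0$ such that $$\int|\Phi(y)-\Phi(y-\delta)|\,dy\le C\,|\delta|^\tau$$ for any $\delta\in\mathbb{R}$. In other words, $\Phi$ belongs to the Besov space $\Lambda^{1,\infty}_\tau$.
   Context: Setting (one-dimensional case of L.-S. Young's axioms for systems with a Markov tower with exponential return-time tail). $m$ and $|\cdot|$ denote Lebesgue measure on $\mathbb{R}$. $f$ is a map of a bounded interval $I$ into itself with $B:=\Vert f'\Vert_\infty\in(1,\infty)$. There is an interval $\Lambda\subset I$ of positive length, a countable family of pairwise disjoint subintervals $\Lambda_j\subset\Lambda$ ($j\ge1$) with $m(\Lambda\setminus\bigcup_j\Lambda_j)=0$, and integers $R_j\ge1$ such that for every $j$ and $1\le k\le R_j$ the map $f^k|_{\Lambda_j}$ is a diffeomorphism onto its image (an interval), and $f^{R_j}(\Lambda_j)=\Lambda$. The return-time function is $R=R_j$ on $\Lambda_j$, and $f^R:\Lambda\to\Lambda$ is the (a.e. defined) return map $x\mapsto f^{R(x)}(x)$. The return time has an exponential tail: $m\{R>n\}\le C e^{-\theta_0 n}$ for some $C,\theta_0>0$. Separation time: for $x,x'\in\Lambda$, let $\ell\ge0$ be the smallest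 integer such that $(f^R)^\ell(x)$ and $(f^R)^\ell(x')$ lie in different elements $\Lambda_i$; $s(x,x')=\sum_{i<\ell}R((f^R)^i(x))$ is the corresponding number of iterates of $f$. For $y,y'\in f^k(\Lambda_j)$ with $0\le k<R_j$, $s(y,y')=(R_j-k)+s(f^{R_j-k}(y),f^{R_j-k}(y'))$, the iterates being taken along the branch issued from $\Lambda_j$. Contraction and distortion: there are $C>0$, $\alpha\in(0,1)$ such that for $x,x'\in\Lambda$ and $0\le k\le n<s(x,x')$: $|f^n(x)-f^n(x')|\le C\alpha^{s(x,x')-n}$ and $\big|\log\prod_{i=k}^n\frac{f'(f^i(x))}{f'(f^i(x'))}\big|\le C\alpha^{s(x,x')-n}$. Invariant density: $f^R$ has an absolutely continuous invariant measure on $\Lambda$ with density $\varphi$, bounded above and bounded away from $0$. The SRB measure $\mu$ of $f$ has density $$\Phi(y)=\sum_{j\ge1}\sum_{k=0}^{R_j-1}a_{kj}(y)\,\chi_{f^k(\Lambda_j)}(y),\qquad a_{kj}(y)=\frac{\varphi(y_{kj})}{|(f^k)'(y_{kj})|}\ \text{ for } y\in f^k(\Lambda_j),$$ where $y_{kj}$ is the unique point of $\Lambda_j$ with $f^k(y_{kj})=y$, $a_{kj}=0$ outside $f^k(\Lambda_j)$, $\chi$ denotes indicator functions, and $\varphi$ is normalized so that $\mu$ is a probability. $\Phi$ is extended by $0$ outside $I$. Properties recalled from Young's paper, which fix the constants $\theta$ and $\alpha$ of the statement: (i) there is $\theta>0$ with $\sum_j e^{\theta R_j}|\Lambda_j|<\infty$;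 (ii) there are $C>0$, $\alpha\in(0,1)$ such that for all $j$, all $k<R_j$ and all $y,y'\in f^k(\Lambda_j)$, $\big|\frac{a_{kj}(y)}{a_{kj}(y')}-1\big|\le C\alpha^{s(y,y')}$; (iii) there is $C>1$ such that for all $j$, $k<R_j$, $y\in f^k(\Lambda_j)$: $C^{-1}|\Lambda_j|\le a_{kj}(y)\,|f^k(\Lambda_j)|\le C|\Lambda_j|$; (iv) for all $j$, $k<R_j$, $y\in f^k(\Lambda_j)$: $a_{kj}(y)\le C B^{R_j-k}|\Lambda_j|/|\Lambda|$. The Besov space $\Lambda^{1,\infty}_\tau$ ($0<\tau<1$) consists of the $h\in L^1(\mathbb{R})$ for which $\sup_{\delta\ne0}|\delta|^{-\tau}\int|h(y)-h(y-\delta)|\,dy<\infty$. *)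

theory Defs
  imports "HOL-Probability.Probability"
begin

text \<open>
  The data of a one-dimensional Markov tower are a map \<open>f\<close>, a reference interval \<open>L\<close>, a countable
  family of intervals \<open>P j\<close> indexed by \<open>j \<in> J\<close> (with \<open>J\<close> finite or infinite), and return times
  \<open>R j\<close>.  The intervals may be open, half-open or closed, so at the points of an interval \<open>S\<close>
  derivatives are those of the restriction to \<open>S\<close>, that is, one-sided at an end point belonging to
  \<open>S\<close>.  For this reason \<open>C1_differentiable_on\<close>, which uses two-sided derivatives, is not used.
\<close>

definition C1_within :: "real set \<Rightarrow> (real \<Rightarrow> real) \<Rightarrow> bool" where
  "C1_within S g \<longleftrightarrow>
     (\<exists>g'. (\<forall>x\<in>S. (g has_real_derivative g' x) (at x within S)) \<and> continuous_on S g')"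

definition diffeo_onto_image :: "real set \<Rightarrow> (real \<Rightarrow> real) \<Rightarrow> bool" where
  "diffeo_onto_image S g \<longleftrightarrow>
     inj_on g S \<and> C1_within S g \<and> C1_within (g ` S) (inv_into S g)"

definition element_index :: "nat set \<Rightarrow> (nat \<Rightarrow> real set) \<Rightarrow> real \<Rightarrow> nat" where
  "element_index J P x = (THE j. j \<in> J \<and> x \<in> P j)"

definition return_time :: "nat set \<Rightarrow> (nat \<Rightarrow> real set) \<Rightarrow> (nat \<Rightarrow> nat) \<Rightarrow> real \<Rightarrow> nat" where
  "return_time J P R x = R (element_index J P x)"

text \<open>
  Only the values of \<open>return_time\<close> and \<open>return_map\<close> on \<open>\<Union>j\<in>J. P j\<close> are meaningful.
\<close>

definition return_map ::
  "(real \<Rightarrow> real) \<Rightarrow> nat set \<Rightarrow> (nat \<Rightarrow> real set) \<Rightarrow> (nat \<Rightarrow> nat) \<Rightarrow> real \<Rightarrow> real" where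
  "return_map f J P R x = (f ^^ return_time J P R x) x"

text \<open>
  The separation time is infinite for pairs that are never separated.  A pair also counts as
  separated as soon as one of the two orbits of the return map meets the null set outside
  \<open>\<Union>j\<in>J. P j\<close>, where the return map is not defined; this makes the separation time meaningful for
  all pairs of points.
\<close>

definition separated ::
  "(real \<Rightarrow> real) \<Rightarrow> nat set \<Rightarrow> (nat \<Rightarrow> real set) \<Rightarrow> (nat \<Rightarrow> nat) \<Rightarrow> real \<Rightarrow> real \<Rightarrow> nat \<Rightarrow> bool" where
  "separated f J P R x x' l \<longleftrightarrow>
     \<not> (\<exists>i\<in>J. (return_map f J P R ^^ l) x \<in> P i \<and> (return_map f J P R ^^ l) x' \<in> P i)"

definition separation_time ::
  "(real \<Rightarrow> real) \<Rightarrow> nat set \<Rightarrow> (nat \<Rightarrow> real set) \<Rightarrow> (nat \<Rightarrow> nat) \<Rightarrow> real \<Rightarrow> real \<Rightarrow> enat" where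
  "separation_time f J P R x x' =
     (if \<exists>l. separated f J P R x x' l
      then enat (\<Sum>i < (LEAST l. separated f J P R x x' l).
                   return_time J P R ((return_map f J P R ^^ i) x))
      else \<infinity>)"

text \<open>Separation time of two points of the tower level \<open>(f ^^ k) ` P j\<close>, where \<open>k < R j\<close>.\<close>

definition level_separation_time ::
  "(real \<Rightarrow> real) \<Rightarrow> nat set \<Rightarrow> (nat \<Rightarrow> real set) \<Rightarrow> (nat \<Rightarrow> nat) \<Rightarrow> nat \<Rightarrow> nat \<Rightarrow> real \<Rightarrow> real \<Rightarrow> enat"
where
  "level_separation_time f J P R j k y y' =
     enat (R j - k) + separation_time f J P R ((f ^^ (R j - k)) y) ((f ^^ (R j - k)) y')"

text \<open>The convention \<open>\<alpha>\<^sup>\<infinity> = 0\<close>, appropriate for \<open>0 < \<alpha> < 1\<close>.\<close>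

definition enat_power :: "real \<Rightarrow> enat \<Rightarrow> real" where
  "enat_power \<alpha> s = (case s of enat n \<Rightarrow> \<alpha> ^ n | \<infinity> \<Rightarrow> 0)"

text \<open>
  If \<open>tower_level f J P R x i = (j, k)\<close> then at time \<open>i\<close> the orbit of \<open>x\<close> is in \<open>(f ^^ k) ` P j\<close>,
  as a point issued from \<open>P j\<close> at its last return.  The factor \<open>f'(f\<^sup>i(x))\<close> of the derivative of an
  iterate of \<open>f\<close> along the branch followed by \<open>x\<close> is the derivative of \<open>f\<close> restricted to that set.
\<close>

primrec tower_level ::
  "(real \<Rightarrow> real) \<Rightarrow> nat set \<Rightarrow> (nat \<Rightarrow> real set) \<Rightarrow> (nat \<Rightarrow> nat) \<Rightarrow> real \<Rightarrow> nat \<Rightarrow> nat \<times> nat" where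
  "tower_level f J P R x 0 = (element_index J P x, 0)"
| "tower_level f J P R x (Suc i) =
     (case tower_level f J P R x i of (j, k) \<Rightarrow>
        if Suc k < R j then (j, Suc k) else (element_index J P ((f ^^ Suc i) x), 0))"

definition orbit_deriv ::
  "(real \<Rightarrow> real) \<Rightarrow> nat set \<Rightarrow> (nat \<Rightarrow> real set) \<Rightarrow> (nat \<Rightarrow> nat) \<Rightarrow> real \<Rightarrow> nat \<Rightarrow> real" where
  "orbit_deriv f J P R x i =
     (case tower_level f J P R x i of (j, k) \<Rightarrow>
        vector_derivative f (at ((f ^^ i) x) within (f ^^ k) ` P j))"

definition exponential_tail ::
  "nat set \<Rightarrow> (nat \<Rightarrow> real set) \<Rightarrow> (nat \<Rightarrow> nat) \<Rightarrow> bool" where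
  "exponential_tail J P R \<longleftrightarrow>
     (\<exists>C>0. \<exists>\<theta>\<^sub>0>0. \<forall>n::nat.
        measure lebesgue {x \<in> (\<Union>j\<in>J. P j). return_time J P R x > n} \<le> C * exp (- \<theta>\<^sub>0 * real n))"

definition contraction_and_distortion ::
  "(real \<Rightarrow> real) \<Rightarrow> real set \<Rightarrow> nat set \<Rightarrow> (nat \<Rightarrow> real set) \<Rightarrow> (nat \<Rightarrow> nat) \<Rightarrow> bool" where
  "contraction_and_distortion f L J P R \<longleftrightarrow>
     (\<exists>C>0. \<exists>\<beta>\<in>{0<..<1}. \<forall>x\<in>L. \<forall>x'\<in>L. \<forall>k n.
        k \<le> n \<and> enat n < separation_time f J P R x x' \<longrightarrow>
          \<bar>(f ^^ n) x - (f ^^ n) x'\<bar> \<le> C * enat_power \<beta> (separation_time f J P R x x' - enat n) \<and>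
          \<bar>ln (\<Prod>i=k..n. orbit_deriv f J P R x i / orbit_deriv f J P R x' i)\<bar>
            \<le> C * enat_power \<beta> (separation_time f J P R x x' - enat n))"

text \<open>
  The map \<open>f\<close> is only required to be differentiable almost everywhere on \<open>I\<close>, with \<open>B\<close> the
  \<open>L\<^sup>\<infinity>\<close>-norm of its derivative; it may be discontinuous between the pieces.
\<close>

definition young_map ::
  "(real \<Rightarrow> real) \<Rightarrow> real set \<Rightarrow> real \<Rightarrow> real set \<Rightarrow> nat set \<Rightarrow> (nat \<Rightarrow> real set) \<Rightarrow> (nat \<Rightarrow> nat) \<Rightarrow> bool"
where
  "young_map f I B L J P R \<longleftrightarrow>
     is_interval I \<and> bounded I \<and> f ` I \<subseteq> I \<and>
     (AE x in lebesgue_on I. f differentiable (at x)) \<and>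
     esssup (lebesgue_on I) (\<lambda>x. ereal \<bar>deriv f x\<bar>) = ereal B \<and> 1 < B \<and>
     is_interval L \<and> L \<subseteq> I \<and> 0 < measure lebesgue L \<and>
     (\<forall>j\<in>J. is_interval (P j) \<and> P j \<subseteq> L) \<and>
     disjoint_family_on P J \<and>
     emeasure lebesgue (L - (\<Union>j\<in>J. P j)) = 0 \<and>
     (\<forall>j\<in>J. 1 \<le> R j \<and>
        (\<forall>k\<in>{1..R j}. diffeo_onto_image (P j) (f ^^ k) \<and> is_interval ((f ^^ k) ` P j)) \<and>
        (f ^^ R j) ` P j = L) \<and>
     exponential_tail J P R \<and>
     contraction_and_distortion f L J P R"

text \<open>
  \<open>\<phi>\<close> is the density on \<open>L\<close> of an absolutely continuous measure invariant under the return map.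
\<close>

definition return_invariant_density ::
  "(real \<Rightarrow> real) \<Rightarrow> real set \<Rightarrow> nat set \<Rightarrow> (nat \<Rightarrow> real set) \<Rightarrow> (nat \<Rightarrow> nat) \<Rightarrow> (real \<Rightarrow> real) \<Rightarrow> bool"
where
  "return_invariant_density f L J P R \<phi> \<longleftrightarrow>
     \<phi> \<in> borel_measurable (lebesgue_on L) \<and>
     (\<exists>c>0. \<exists>C. AE x in lebesgue_on L. c \<le> \<phi> x \<and> \<phi> x \<le> C) \<and>
     (let \<nu> = density (lebesgue_on L) (\<lambda>x. ennreal (\<phi> x)) in
        \<forall>A\<in>sets borel.
          emeasure \<nu> {x \<in> (\<Union>j\<in>J. P j). return_map f J P R x \<in> A} = emeasure \<nu> (A \<inter> L))"

definition tower_coeff ::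
  "(real \<Rightarrow> real) \<Rightarrow> (nat \<Rightarrow> real set) \<Rightarrow> (real \<Rightarrow> real) \<Rightarrow> nat \<Rightarrow> nat \<Rightarrow> real \<Rightarrow> real" where
  "tower_coeff f P \<phi> k j y =
     (if y \<in> (f ^^ k) ` P j
      then let x = inv_into (P j) (f ^^ k) y
           in \<phi> x / \<bar>vector_derivative (f ^^ k) (at x within P j)\<bar>
      else 0)"

text \<open>
  The density on the real line.  It vanishes outside \<open>\<Union>j\<in>J. \<Union>k<R j. (f ^^ k) ` P j\<close>, hence outside
  the interval \<open>I\<close>, and \<open>infsum\<close> gives it the value 0 at points where the series diverges.
\<close>

definition srb_density ::
  "(real \<Rightarrow> real) \<Rightarrow> nat set \<Rightarrow> (nat \<Rightarrow> real set) \<Rightarrow> (nat \<Rightarrow> nat) \<Rightarrow> (real \<Rightarrow> real) \<Rightarrow> real \<Rightarrow> real" where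
  "srb_density f J P R \<phi> y =
     (\<Sum>\<^sub>\<infinity>j\<in>J. \<Sum>k<R j. tower_coeff f P \<phi> k j y * indicator ((f ^^ k) ` P j) y)"

definition srb_measure ::
  "(real \<Rightarrow> real) \<Rightarrow> nat set \<Rightarrow> (nat \<Rightarrow> real set) \<Rightarrow> (nat \<Rightarrow> nat) \<Rightarrow> (real \<Rightarrow> real) \<Rightarrow> real measure" where
  "srb_measure f J P R \<phi> = density lebesgue (\<lambda>y. ennreal (srb_density f J P R \<phi> y))"

text \<open>The Besov space \<open>\<Lambda>\<^sub>\<tau>\<close> of exponents \<open>1, \<infinity>\<close> on the real line.\<close>

definition besov_1_inf :: "real \<Rightarrow> (real \<Rightarrow> real) set" where
  "besov_1_inf \<tau> =
     {h. integrable lebesgue h \<and>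
         bdd_above ((\<lambda>\<delta>. \<bar>\<delta>\<bar> powr (- \<tau>) * (LINT y|lebesgue. \<bar>h y - h (y - \<delta>)\<bar>)) ` (UNIV - {0}))}"

end

theory Submission
  imports Defs
begin

text \<open>
  The measure \<open>a_kj(y) dy\<close> on the level \<open>S = f^k(\<Lambda>_j)\<close> is the image of \<open>\<nu> = \<phi> dx\<close> restricted to \<open>\<Lambda>_j\<close>,
  and \<open>\<nu>\<close> is invariant under the return map.  The integral of \<open>|a_kj(y) - a_kj(y - \<delta>)|\<close> splits into
  three parts.  Where only one of \<open>y\<close>, \<open>y - \<delta>\<close> lies in \<open>S\<close>, the bounds on the size of \<open>a_kj\<close> apply.  Where
  both do and \<open>s(y - \<delta>, y) > n\<close>, regularity of \<open>a_kj\<close> gives a factor \<open>\<alpha>^n\<close>.  In the remaining case some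
  return of \<open>y\<close>, among the first \<open>n\<close> and before time \<open>n\<close>, falls within \<open>r = B^n |\<delta>|\<close> of the boundary of
  an element \<open>\<Lambda>_i\<close>.  By invariance, the \<open>\<nu>\<close>-measure of the points with such a return is at most \<open>n + 1\<close>
  times that of the \<open>r\<close>-neighbourhood of the boundaries, so no distortion estimate for iterated
  returns is needed.  Since \<open>|\<Lambda>_i| \<ge> B^{-R_i} |\<Lambda>|\<close>, that neighbourhood has measure \<open>O(r^t)\<close> with
  \<open>t = min {1, \<theta> / log B}\<close>.  With \<open>B^n\<close> about \<open>|\<delta>|^{-1/2}\<close> every exponent below \<open>t/2\<close> and
  \<open>log \<alpha>^{-1} / (2 log B)\<close> is reached, and \<open>t^3/4 < t/2\<close>.
\<close>

section \<open>Preliminaries on the real line\<close>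

text \<open>A point thrown out of \<open>S\<close> by the shift lies within |d| of the end point
  towards which it moves, so the set is contained in one closed interval of length |d|.\<close>

lemma measure_interval_diff_translate:
  fixes S :: "real set"
  assumes "is_interval S" "bounded S"
  shows "emeasure lebesgue {y \<in> S. y - d \<notin> S} \<le> ennreal \<bar>d\<bar>"
proof (cases "S = {}")
  case False
  have bb: "bdd_below S" "bdd_above S"
    using assms(2) bounded_imp_bdd_below bounded_imp_bdd_above by auto
  have "{y \<in> S. y - d \<notin> S} \<subseteq> (if 0 \<le> d then {Inf S..Inf S + d} else {Sup S + d..Sup S})"
  proof
    fix y assume "y \<in> {y \<in> S. y - d \<notin> S}"
    then have y: "y \<in> S" "y - d \<notin> S" by auto
    show "y \<in> (if 0 \<le> d then {Inf S..Inf S + d} else {Sup S + d..Sup S})"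
    proof (cases "0 \<le> d")
      case True
      have "\<not> Inf S < y - d"
      proof
        assume "Inf S < y - d"
        then obtain z where "z \<in> S" "z < y - d"
          using cInf_less_iff[OF False bb(1)] by blast
        then show False
          using assms(1) y True unfolding is_interval_1 by (metis diff_ge_0_iff_ge diff_le_eq
            le_add_same_cancel1 less_imp_le)
      qed
      then show ?thesis using True y cInf_lower[OF y(1) bb(1)] by auto
    next
      case False
      have "\<not> y - d < Sup S"
      proof
        assume "y - d < Sup S"
        then obtain z where "z \<in> S" "y - d < z"
          using less_cSup_iff[OF \<open>S \<noteq> {}\<close> bb(2)] by blast
        moreover have "y \<le> y - d" using False by simp
        ultimately show False
          using assms(1) y unfolding is_interval_1 by (meson less_imp_le)
      qed
      then show ?thesis using False y cSup_upper[OF y(1) bb(2)] by auto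
    qed
  qed
  then have "emeasure lebesgue {y \<in> S. y - d \<notin> S} \<le>
      emeasure lebesgue (if 0 \<le> d then {Inf S..Inf S + d} else {Sup S + d..Sup S})"
    by (intro emeasure_mono) auto
  also have "\<dots> \<le> ennreal \<bar>d\<bar>" by auto
  finally show ?thesis .
qed simp

text \<open>Interpolates between the trivial bound 1 and the linear bound \<open>x\<close>; this is
  how the exponent \<open>t\<close> enters the estimates at the edges of levels and near the
  cuts.\<close>

lemma min_one_le_powr:
  fixes x t :: real
  assumes "0 \<le> x" "0 < t" "t \<le> 1"
  shows "min 1 x \<le> x powr t"
proof (cases "x \<ge> 1")
  case True
  then show ?thesis using assms by (simp add: ge_one_powr_ge_zero)
next
  case False
  then show ?thesis
    using powr_mono'[of t 1 x] assms by simp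
qed

text \<open>Absorbs polynomial factors, such as the number of levels or of returns, into an
  exponential of arbitrarily small rate.\<close>

lemma of_nat_le_exp:
  assumes "0 < (a::real)" 
  shows "real n \<le> exp (a * real n) / a"
proof -
  have "a * real n \<le> exp (a * real n)"
    using exp_ge_add_one_self[of "a * real n"] by linarith
  then show ?thesis using assms by (simp add: field_simps)
qed

lemma bounded_interval_lmeasurable:
  assumes "is_interval (S::real set)" "bounded S"
  shows "S \<in> lmeasurable"
  by (intro measurable_convex is_interval_convex assms)

lemma measurable_translate:
  fixes d :: real
  shows "(\<lambda>y. y - d) \<in> lebesgue \<rightarrow>\<^sub>M lebesgue"
  using lebesgue_affine_measurable[where c = "\<lambda>x::real. 1" and t = "- d"] by (simp add: algebra_simps)

lemma funpow_add_apply: "(f ^^ (m + k)) x = (f ^^ m) ((f ^^ k) x)"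
  by (simp add: funpow_add)

lemma ennreal_abs_suminf_diff_le:
  fixes u v :: "nat \<Rightarrow> real"
  assumes "summable u" "summable v" "\<And>j. 0 \<le> u j" "\<And>j. 0 \<le> v j"
  shows "ennreal \<bar>suminf u - suminf v\<bar> \<le> (\<Sum>j. ennreal \<bar>u j - v j\<bar>)"
proof -
  have sm: "summable (\<lambda>j. \<bar>u j - v j\<bar>)"
  proof (rule summable_comparison_test')
    show "summable (\<lambda>j. u j + v j)" using assms by (intro summable_add)
    show "norm \<bar>u j - v j\<bar> \<le> u j + v j" if "j \<ge> 0" for j
      using assms(3)[of j] assms(4)[of j] by simp
  qed
  have "\<bar>suminf u - suminf v\<bar> \<le> (\<Sum>j. \<bar>u j - v j\<bar>)"
    using summable_rabs[OF sm] suminf_diff[OF assms(1,2)] by simp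
  then have "ennreal \<bar>suminf u - suminf v\<bar> \<le> ennreal (\<Sum>j. \<bar>u j - v j\<bar>)"
    by (rule ennreal_leI)
  also have "\<dots> = (\<Sum>j. ennreal \<bar>u j - v j\<bar>)"
    using sm by (intro suminf_ennreal2[symmetric]) auto
  finally show ?thesis .
qed

lemma infsum_eq_enn2real:
  fixes u :: "nat \<Rightarrow> real"
  assumes "\<And>j. 0 \<le> u j"
  shows "infsum u UNIV = enn2real (\<Sum>j. ennreal (u j))"
proof (cases "summable u")
  case True
  then have "(u has_sum suminf u) UNIV"
    using assms by (intro norm_summable_imp_has_sum) (auto simp: summable_sums)
  then show ?thesis
    using True assms suminf_nonneg[OF True] by (simp add: infsumI suminf_ennreal2)
next
  \<comment> \<open>Divergence is settled by default values: \<open>infsum\<close> is 0 here, and so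
    is \<open>enn2real\<close> of \<open>top\<close>.\<close>
  case False
  then have "\<not> u summable_on UNIV" using summable_on_imp_summable by blast
  moreover have "(\<Sum>j. ennreal (u j)) = top"
    using False assms summable_suminf_not_top by blast
  ultimately show ?thesis by (simp add: infsum_not_exists)
qed

text \<open>With \<open>x\<close> the size of the shift, \<open>a ^ n\<close> is the gain from
  regularity and the other term the mass of the points that come close to a cut. For
  \<open>B ^ n\<close> of order \<open>x powr (- 1 / 2)\<close> the latter is of order
  \<open>x powr (t / 2)\<close> up to a factor quadratic in \<open>n\<close>, and the gap between
  \<open>\<tau>\<close> and \<open>t / 2\<close> pays for that factor.\<close>

lemma balanced_scale:
  fixes a B t \<tau> :: real
  assumes a: "0 < a" "a < 1" and B: "1 < B" and t: "0 < \<tau>" "\<tau> < t / 2" "2 * \<tau> * ln B < ln (1 / a)"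
  shows "\<exists>c>0. \<forall>x. 0 < x \<and> x < 1 \<longrightarrow>
    (\<exists>n. a ^ n \<le> c * x powr \<tau> \<and> real n * real (Suc n) * (B ^ n * x) powr t \<le> c * x powr \<tau>)"
proof -
  define \<beta> where "\<beta> = ln B"
  \<comment> \<open>Since \<open>2 * n * \<beta> \<le> l\<close>, a factor
    \<open>exp (2 * e * n)\<close> costs at most \<open>exp ((t / 2 - \<tau>) * l)\<close>, which is
    the room between \<open>x powr (t / 2)\<close> and \<open>x powr \<tau>\<close>.\<close>
  define e where "e = (t / 2 - \<tau>) * \<beta>"
  have \<beta>: "0 < \<beta>" using B by (simp add: \<beta>_def)
  have e: "0 < e" using t \<beta> by (simp add: e_def)
  define c where "c = max (1 / a) (exp e / e\<^sup>2)"
  have "\<exists>n. a ^ n \<le> c * x powr \<tau> \<and> real n * real (Suc n) * (B ^ n * x) powr t \<le> c * x powr \<tau>"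
    if x: "0 < x" "x < 1" for x
  proof -
    define l where "l = - ln x"
    have l: "0 < l" "x = exp (- l)" using x by (simp_all add: l_def)
    \<comment> \<open>This choice makes \<open>B ^ n\<close> comparable to \<open>x powr (- 1 / 2)\<close>.\<close>
    define n where "n = nat \<lfloor>l / (2 * \<beta>)\<rfloor>"
    have "real n \<le> l / (2 * \<beta>)" "l / (2 * \<beta>) < real n + 1"
      using l \<beta> by (simp_all add: n_def)
    then have n: "2 * (real n * \<beta>) \<le> l" "l < 2 * (real (Suc n) * \<beta>)"
      using \<beta> by (simp_all add: field_simps)
    have xp: "x powr s = exp (- (s * l))" for s using x by (simp add: powr_def l_def)
    have Bn: "B ^ n = exp (real n * \<beta>)" using B by (simp add: \<beta>_def exp_of_nat_mult)
    \<comment> \<open>The floor only gives \<open>l < 2 * Suc n * \<beta>\<close>, so the estimate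
      is for \<open>a ^ Suc n\<close>; returning to \<open>n\<close> costs the factor
      \<open>1 / a\<close> in \<open>c\<close>.\<close>
    have "a ^ Suc n = exp (- (real (Suc n) * ln (1 / a)))"
      using a by (simp add: ln_div exp_of_nat_mult del: power_Suc of_nat_Suc)
    also have "\<dots> \<le> x powr \<tau>"
    proof -
      have "\<tau> * l \<le> \<tau> * (2 * (real (Suc n) * \<beta>))" using n t by (intro mult_left_mono) auto
      also have "\<dots> = real (Suc n) * (2 * \<tau> * ln B)" by (simp add: \<beta>_def)
      also have "\<dots> \<le> real (Suc n) * ln (1 / a)" using t by (intro mult_left_mono) auto
      finally show ?thesis by (simp add: xp del: of_nat_Suc)
    qed
    finally have 1: "a ^ n \<le> 1 / a * x powr \<tau>" using a by (simp add: field_simps)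
    have "real n * real (Suc n) \<le> (exp (e * real n) / e) * (exp (e * real (Suc n)) / e)"
      using e by (intro mult_mono of_nat_le_exp) auto
    also have "\<dots> = exp e / e\<^sup>2 * exp (e * (2 * real n))"
      by (simp add: power2_eq_square algebra_simps flip: exp_add)
    finally have "real n * real (Suc n) * (B ^ n * x) powr t \<le>
        exp e / e\<^sup>2 * exp (e * (2 * real n)) * (B ^ n * x) powr t"
      by (intro mult_right_mono) auto
    also have powr_eq: "(B ^ n * x) powr t = exp (t * (real n * \<beta> - l))"
      unfolding Bn l(2) by (simp add: powr_def flip: exp_add)
    also have "exp e / e\<^sup>2 * exp (e * (2 * real n)) * exp (t * (real n * \<beta> - l)) =
        exp e / e\<^sup>2 * exp (e * (2 * real n) + t * (real n * \<beta> - l))"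
      by (simp add: exp_add)
    also have "\<dots> \<le> exp e / e\<^sup>2 * x powr \<tau>"
    proof -
      have "e * (2 * real n) + t * (real n * \<beta> - l) = (t / 2 - \<tau>) * (2 * (real n * \<beta>)) + t / 2 * (2 * (real n * \<beta>)) - t * l"
        by (simp add: e_def algebra_simps)
      also have "\<dots> \<le> (t / 2 - \<tau>) * l + t / 2 * l - t * l"
        using n t by (intro diff_right_mono add_mono mult_left_mono) auto
      also have "\<dots> = - (\<tau> * l)" by (simp add: field_simps)
      finally show ?thesis using e by (intro mult_left_mono) (simp_all add: xp)
    qed
    finally have 2: "real n * real (Suc n) * (B ^ n * x) powr t \<le> exp e / e\<^sup>2 * x powr \<tau>"
      unfolding powr_eq .
    have "1 / a * x powr \<tau> \<le> c * x powr \<tau>" "exp e / e\<^sup>2 * x powr \<tau> \<le> c * x powr \<tau>"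
      by (intro mult_right_mono; simp add: c_def)+
    then show ?thesis using 1 2 by (intro exI[of _ n]) linarith
  qed
  moreover have "0 < c" using a by (simp add: c_def less_max_iff_disj)
  ultimately show ?thesis by blast
qed

section \<open>Branches of the tower\<close>

locale markov_tower =
  fixes f :: "real \<Rightarrow> real" and I :: "real set" and B :: real and L :: "real set"
    and J :: "nat set" and P :: "nat \<Rightarrow> real set" and R :: "nat \<Rightarrow> nat"
  assumes young: "young_map f I B L J P R"
begin

abbreviation "F \<equiv> return_map f J P R"

lemma B_gt_1: "1 < B"
  and interval_L: "is_interval L" and L_subset: "L \<subseteq> I" and L_pos: "0 < measure lebesgue L"
  and interval_P: "j \<in> J \<Longrightarrow> is_interval (P j)" and P_subset: "j \<in> J \<Longrightarrow> P j \<subseteq> L"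
  and disjoint_P: "disjoint_family_on P J"
  and null_complement: "emeasure lebesgue (L - (\<Union>j\<in>J. P j)) = 0"
  and R_ge_1: "j \<in> J \<Longrightarrow> 1 \<le> R j"
  and return_onto: "j \<in> J \<Longrightarrow> (f ^^ R j) ` P j = L"
  and bounded_I: "bounded I" and f_I: "f ` I \<subseteq> I"
  using young by (auto simp: young_map_def)

text \<open>The axioms speak of \<open>1 \<le> k\<close>, and level 0 is the element itself. The
  same case distinction recurs for injectivity and smoothness.\<close>

lemma level_interval:
  assumes "j \<in> J" "k \<le> R j"
  shows "is_interval ((f ^^ k) ` P j)"
  using young assms by (cases "k = 0") (auto simp: young_map_def)

lemma level_inj:
  assumes "j \<in> J" "k \<le> R j"
  shows "inj_on (f ^^ k) (P j)"
  using young assms by (cases "k = 0") (auto simp: young_map_def diffeo_onto_image_def)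

lemma level_C1:
  assumes "j \<in> J" "k \<le> R j"
  obtains g' where "\<And>x. x \<in> P j \<Longrightarrow> ((f ^^ k) has_real_derivative g' x) (at x within P j)"
    "continuous_on (P j) g'"
proof (cases "k = 0")
  case True
  then show ?thesis using that[of "\<lambda>_. 1"] by (auto simp: id_def)
next
  case False
  then have "C1_within (P j) (f ^^ k)"
    using young assms by (auto simp: young_map_def diffeo_onto_image_def)
  then show ?thesis using that unfolding C1_within_def by blast
qed

lemma level_inv_C1:
  assumes "j \<in> J" "k \<le> R j"
  obtains g' where "\<And>y. y \<in> (f ^^ k) ` P j \<Longrightarrow>
      (inv_into (P j) (f ^^ k) has_real_derivative g' y) (at y within (f ^^ k) ` P j)"
    "continuous_on ((f ^^ k) ` P j) g'"
proof (cases "k = 0")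
  case True
  have "((inv_into (P j) id) has_real_derivative 1) (at y within P j)" if "y \<in> P j" for y
  unfolding has_field_derivative_def
  proof (rule has_derivative_transform[OF that _ DERIV_ident[unfolded has_field_derivative_def]])
    show "inv_into (P j) id x = x" if "x \<in> P j" for x
      using inv_into_f_f[of id "P j" x] that by simp
  qed
  then show ?thesis using that[of "\<lambda>_. 1"] True by (auto simp: id_def)
next
  case False
  then have "C1_within ((f ^^ k) ` P j) (inv_into (P j) (f ^^ k))"
    using young assms by (auto simp: young_map_def diffeo_onto_image_def)
  then show ?thesis using that unfolding C1_within_def by blast
qed

lemma level_subset: "j \<in> J \<Longrightarrow> (f ^^ k) ` P j \<subseteq> I"
proof (induction k)
  case (Suc k)
  then show ?case using f_I by (auto simp: subset_iff image_iff)
qed (use P_subset L_subset in auto)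

lemma level_bounded: "j \<in> J \<Longrightarrow> bounded ((f ^^ k) ` P j)"
  by (rule bounded_subset[OF bounded_I level_subset])

lemma level_continuous:
  assumes "j \<in> J" "k \<le> R j"
  shows "continuous_on (P j) (f ^^ k)"
proof -
  obtain g' where "\<And>x. x \<in> P j \<Longrightarrow> ((f ^^ k) has_real_derivative g' x) (at x within P j)"
    using level_C1[OF assms] by metis
  then show ?thesis by (rule DERIV_continuous_on)
qed

lemma bounded_L: "bounded L"
  by (rule bounded_subset[OF bounded_I L_subset])

lemma L_sets: "L \<in> sets lebesgue" "L \<in> sets borel" "L \<in> lmeasurable"
  using bounded_interval_lmeasurable[OF interval_L bounded_L]
    real_interval_borel_measurable[OF interval_L] by auto

lemma P_sets: 
  assumes "j \<in> J"
  shows "P j \<in> sets lebesgue" "P j \<in> sets borel" "P j \<in> lmeasurable"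
  using bounded_interval_lmeasurable[OF interval_P[OF assms] bounded_subset[OF bounded_L P_subset[OF assms]]]
    real_interval_borel_measurable[OF interval_P[OF assms]] by auto

lemma level_sets: 
  assumes "j \<in> J" "k \<le> R j"
  shows "(f ^^ k) ` P j \<in> sets lebesgue" "(f ^^ k) ` P j \<in> sets borel" "(f ^^ k) ` P j \<in> lmeasurable"
  using bounded_interval_lmeasurable[OF level_interval[OF assms] level_bounded[OF assms(1)]]
    real_interval_borel_measurable[OF level_interval[OF assms]] by auto

lemma P_not_singleton: "j \<in> J \<Longrightarrow> \<not> P j \<subseteq> {x}"
proof
  assume "j \<in> J" "P j \<subseteq> {x}"
  then have "L \<subseteq> {(f ^^ R j) x}" using return_onto by fastforce
  then have "negligible L" using negligible_subset[OF negligible_sing] by blast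
  then show False using L_pos by (simp add: negligible_imp_measure0)
qed

text \<open>Derivatives within a set are unique only at its limit points. An element is not
  degenerate because its return covers \<open>L\<close>, and injectivity carries this over to its
  levels.\<close>

lemma level_not_trivial_limit:
  assumes "j \<in> J" "k \<le> R j" "y \<in> (f ^^ k) ` P j"
  shows "at y within (f ^^ k) ` P j \<noteq> bot"
proof -
  have not_sub: "\<not> (f ^^ k) ` P j \<subseteq> {y}"
  proof
    assume *: "(f ^^ k) ` P j \<subseteq> {y}"
    obtain x where "x \<in> P j" "y = (f ^^ k) x" using assms by auto
    then have "P j \<subseteq> {x}" using * level_inj[OF assms(1,2)] by (fastforce simp: inj_on_def)
    then show False using P_not_singleton assms by blast
  qed
  have "(f ^^ k) ` P j \<noteq> {x}" for x
    using assms(3) not_sub by (metis order_refl singletonD)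
  then have "y islimpt (f ^^ k) ` P j"
    by (intro connected_imp_perfect is_interval_connected level_interval[OF assms(1,2)] assms(3))
  then show ?thesis by (simp add: trivial_limit_within)
qed

section \<open>Bounds on the expansion along the branches\<close>

lemma AE_deriv_le: "AE x in lebesgue_on I. \<bar>deriv f x\<bar> \<le> B"
proof -
  have "AE x in lebesgue_on I. ereal \<bar>deriv f x\<bar> \<le> ereal B"
    using esssup_AE[where M = "lebesgue_on I" and f = "\<lambda>x. ereal \<bar>deriv f x\<bar>"] young by (simp add: young_map_def)
  then show ?thesis by simp
qed

text \<open>\<open>B\<close> bounds the derivative only almost everywhere. On a level, however,
  \<open>f\<close> is \<open>f ^^ Suc k\<close> composed with the inverse of \<open>f ^^ k\<close>,
  so its derivative is continuous there; exceeding \<open>B\<close> at an interior point would mean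
  exceeding it on a nonempty open set, which is not null.\<close>

lemma level_derivative_bound:
  assumes j: "j \<in> J" "k < R j" and z: "z \<in> interior ((f ^^ k) ` P j)"
  shows "\<exists>d. \<bar>d\<bar> \<le> B \<and> (f has_real_derivative d) (at z)"
proof -
  let ?S = "(f ^^ k) ` P j" and ?h = "inv_into (P j) (f ^^ k)"
  obtain g' where g': "\<And>x. x \<in> P j \<Longrightarrow> ((f ^^ Suc k) has_real_derivative g' x) (at x within P j)"
    "continuous_on (P j) g'" using level_C1[of j "Suc k"] j by auto
  obtain h' where h': "\<And>y. y \<in> ?S \<Longrightarrow> (?h has_real_derivative h' y) (at y within ?S)"
    "continuous_on ?S h'" using level_inv_C1[of j k] j by auto
  define d where "d = (\<lambda>y. g' (?h y) * h' y)"
  have hS: "?h ` ?S = P j" using level_inj[of j k] j by (simp add: inv_into_image_cancel)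
  have eq: "f y = (f ^^ Suc k) (?h y)" if "y \<in> ?S" for y
    using f_inv_into_f[OF that] by simp
  have "(f has_real_derivative d y) (at y within ?S)" if y: "y \<in> ?S" for y
  proof -
    have "?h y \<in> P j" using y by (simp add: inv_into_into del: funpow.simps)
    then have "((f ^^ Suc k) has_real_derivative g' (?h y)) (at (?h y) within ?h ` ?S)"
      using g'(1) hS by (simp del: funpow.simps)
    from DERIV_image_chain[OF this h'(1)[OF y]]
    have "((\<lambda>y. (f ^^ Suc k) (?h y)) has_real_derivative d y) (at y within ?S)"
      by (simp add: d_def comp_def del: funpow.simps)
    then show ?thesis
      unfolding has_field_derivative_def
      using has_derivative_transform[OF y, of f "\<lambda>y. (f ^^ Suc k) (?h y)"] eq by blast
  qed
  then have der: "(f has_real_derivative d y) (at y)" if "y \<in> interior ?S" for y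
    using that by (metis at_within_interior interior_subset subsetD)
  have cont_d: "continuous_on ?S d"
    unfolding d_def
    by (intro continuous_intros h' continuous_on_compose2[OF g'(2)] DERIV_continuous_on[OF h'(1)])
      (use hS in auto)
  have "\<bar>d z\<bar> \<le> B"
  proof (rule ccontr)
    assume "\<not> \<bar>d z\<bar> \<le> B"
    define U where "U = {y \<in> interior ?S. d y \<in> {y. B < \<bar>y\<bar>}}"
    have "open (interior ?S \<inter> d -` {y. B < \<bar>y\<bar>})"
      using cont_d interior_subset
      by (intro continuous_open_preimage open_Collect_less continuous_intros) (auto intro: continuous_on_subset)
    moreover have "U = interior ?S \<inter> d -` {y. B < \<bar>y\<bar>}" by (auto simp: U_def)
    ultimately have "open U" by metis
    moreover have "z \<in> U" using z \<open>\<not> \<bar>d z\<bar> \<le> B\<close> by (auto simp: U_def)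
    ultimately have "\<not> negligible U" using open_not_negligible by blast
    moreover have "AE x in lebesgue. x \<in> I \<longrightarrow> \<bar>deriv f x\<bar> \<le> B"
      using AE_deriv_le young
      by (subst (asm) AE_restrict_space_iff)
         (auto simp: young_map_def real_interval_borel_measurable)
    then have "AE x in lebesgue. x \<notin> U"
    proof (rule AE_mp, intro AE_I2 impI notI)
      fix x assume "x \<in> U" "x \<in> I \<longrightarrow> \<bar>deriv f x\<bar> \<le> B"
      moreover have "x \<in> I"
        using \<open>x \<in> U\<close> level_subset[of j k] j interior_subset by (force simp: U_def)
      ultimately show False using DERIV_imp_deriv[OF der, of x] by (auto simp: U_def)
    qed
    then have "negligible U"
      using \<open>open U\<close> by (subst negligible_iff_null_sets) (auto simp: AE_iff_null_sets)
    ultimately show False by simp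
  qed
  then show ?thesis using der z by blast
qed

text \<open>The mean value theorem on the segment between the two points, which stays in the level
  by convexity. It needs the derivative only at interior points, and continuity up to the end
  points; the latter again comes from factoring \<open>f\<close> through the element.\<close>

lemma level_step_lipschitz:
  assumes j: "j \<in> J" "k < R j" and y: "y \<in> (f ^^ k) ` P j" "y' \<in> (f ^^ k) ` P j"
  shows "\<bar>f y - f y'\<bar> \<le> B * \<bar>y - y'\<bar>"
proof -
  let ?S = "(f ^^ k) ` P j" and ?h = "inv_into (P j) (f ^^ k)"
  have cont: "continuous_on ?S f"
  proof -
    obtain h' where h': "\<And>y. y \<in> ?S \<Longrightarrow> (?h has_real_derivative h' y) (at y within ?S)"
      using level_inv_C1[of j k] j by auto
    have "?h ` ?S \<subseteq> P j"
      by (auto simp del: funpow.simps intro: inv_into_into)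
    then have "continuous_on ?S (\<lambda>y. (f ^^ Suc k) (?h y))"
      using continuous_on_compose2[OF level_continuous[of j "Suc k"] DERIV_continuous_on[OF h']] j
      by (auto simp del: funpow.simps)
    moreover have "(f ^^ Suc k) (?h y) = f y" if "y \<in> ?S" for y
      using f_inv_into_f[OF that] by simp
    ultimately show ?thesis
      by (metis (no_types, lifting) continuous_on_cong)
  qed
  have main: "\<bar>f b - f a\<bar> \<le> B * \<bar>b - a\<bar>" if ab: "a < b" "a \<in> ?S" "b \<in> ?S" for a b
  proof -
    have sub: "{a..b} \<subseteq> ?S"
      using level_interval[of j k] j ab unfolding is_interval_1 by (meson atLeastAtMost_iff less_imp_le subsetI)
    have int: "{a<..<b} \<subseteq> interior ?S"
      by (rule interior_maximal) (use sub in auto)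
    have cab: "continuous_on {a..b} f" using cont sub by (rule continuous_on_subset)
    have dab: "f differentiable (at x)" if "a < x" "x < b" for x
    proof -
      have "x \<in> interior ((f ^^ k) ` P j)" using int that by auto
      then show ?thesis using level_derivative_bound[OF j] real_differentiable_def by blast
    qed
    obtain l z where lz: "a < z" "z < b" "DERIV f z :> l" "f b - f a = (b - a) * l"
      using MVT[OF ab(1) cab dab] by blast
    moreover have "\<bar>l\<bar> \<le> B"
    proof -
      have "z \<in> interior ((f ^^ k) ` P j)" using int lz by auto
      then show ?thesis using level_derivative_bound[OF j] lz(3) DERIV_unique by blast
    qed
    ultimately show ?thesis using ab by (simp add: abs_mult mult.commute mult_left_mono)
  qed
  show ?thesis
    using main[of y y'] main[of y' y] y by (cases y y' rule: linorder_cases) (auto simp: abs_minus_commute)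
qed

lemma level_lipschitz:
  assumes j: "j \<in> J" "k + m \<le> R j" and y: "y \<in> (f ^^ k) ` P j" "y' \<in> (f ^^ k) ` P j"
  shows "\<bar>(f ^^ m) y - (f ^^ m) y'\<bar> \<le> B ^ m * \<bar>y - y'\<bar>"
  using j
proof (induction m)
  case (Suc m)
  have mem: "(f ^^ m) z \<in> (f ^^ (m + k)) ` P j" if z: "z \<in> (f ^^ k) ` P j" for z
  proof -
    obtain x where "x \<in> P j" "z = (f ^^ k) x" using z by blast
    then show ?thesis by (simp only: funpow_add_apply[symmetric] image_eqI)
  qed
  have "\<bar>f ((f ^^ m) y) - f ((f ^^ m) y')\<bar> \<le> B * \<bar>(f ^^ m) y - (f ^^ m) y'\<bar>"
    by (rule level_step_lipschitz[of j "m + k"]) (use Suc.prems y mem in \<open>simp_all del: funpow.simps image_iff\<close>)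
  also have "\<dots> \<le> B * (B ^ m * \<bar>y - y'\<bar>)"
    using Suc.IH Suc.prems B_gt_1 by (intro mult_left_mono) simp_all
  finally show ?case by (simp add: mult.assoc)
qed simp

text \<open>\<open>f ^^ R j\<close> stretches distances by at most \<open>B ^ R j\<close> and maps
  \<open>P j\<close> onto \<open>L\<close>, so the lengths compare. Later this bounds the width of a
  boundary layer by a multiple of the length of its element.\<close>

lemma measure_P_lower:
  assumes j: "j \<in> J"
  shows "measure lebesgue L \<le> B ^ R j * measure lebesgue (P j)"
proof -
  let ?K = "B ^ R j * measure lebesgue (P j)"
  have le: "x - x' \<le> measure lebesgue (P j)" if "x \<in> P j" "x' \<in> P j" for x x'
  proof (cases "x' \<le> x")
    case True
    have "{x'..x} \<subseteq> P j"
      using interval_P[OF j] that unfolding is_interval_1 by (meson atLeastAtMost_iff subsetI)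
    then have "measure lebesgue {x'..x} \<le> measure lebesgue (P j)"
      by (intro measure_mono_fmeasurable) (use P_sets[OF j] in simp_all)
    then show ?thesis using True by simp
  next
    case False
    then show ?thesis using measure_nonneg[of lebesgue "P j"] by linarith
  qed
  have *: "\<bar>x - x'\<bar> \<le> measure lebesgue (P j)" if "x \<in> P j" "x' \<in> P j" for x x'
    using le[OF that] le[OF that(2,1)] by linarith
  have K: "z \<le> z' + ?K" if z: "z \<in> L" "z' \<in> L" for z z'
  proof -
    obtain x x' where x: "x \<in> P j" "x' \<in> P j" "z = (f ^^ R j) x" "z' = (f ^^ R j) x'"
      using z return_onto[OF j] by blast
    have "\<bar>z - z'\<bar> \<le> B ^ R j * \<bar>x - x'\<bar>"
      unfolding x(3,4) by (rule level_lipschitz[of j 0]) (use j x in simp_all)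
    also have "\<dots> \<le> ?K" using *[OF x(1,2)] B_gt_1 by (intro mult_left_mono) simp_all
    finally show ?thesis by linarith
  qed
  have ne: "L \<noteq> {}" using L_pos by (metis measure_empty less_irrefl)
  have bb: "bdd_below L" "bdd_above L"
    using bounded_L bounded_imp_bdd_below bounded_imp_bdd_above by auto
  have "Sup L \<le> z' + ?K" if "z' \<in> L" for z'
    using ne K that by (intro cSup_least) simp_all
  then have "Sup L - ?K \<le> Inf L"
    using ne by (intro cInf_greatest) (simp_all add: diff_le_eq)
  moreover have "L \<subseteq> {Inf L..Sup L}"
    using bb by (auto intro: cInf_lower cSup_upper)
  then have "measure lebesgue L \<le> measure lebesgue {Inf L..Sup L}"
    by (intro measure_mono_fmeasurable) (use L_sets in auto)
  moreover have "Inf L \<le> Sup L" using ne bb cInf_le_cSup by blast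
  ultimately show ?thesis by simp
qed

section \<open>Separation near the boundaries of the partition\<close>

lemma element_index_eq: "j \<in> J \<Longrightarrow> x \<in> P j \<Longrightarrow> element_index J P x = j"
  unfolding element_index_def
  using disjoint_P by (intro the_equality) (auto simp: disjoint_family_on_def)

lemma return_time_eq: "j \<in> J \<Longrightarrow> x \<in> P j \<Longrightarrow> return_time J P R x = R j"
  by (simp add: return_time_def element_index_eq)

lemma return_map_eq: "j \<in> J \<Longrightarrow> x \<in> P j \<Longrightarrow> F x = (f ^^ R j) x"
  by (simp add: return_map_def return_time_eq)

lemma return_map_in: "j \<in> J \<Longrightarrow> x \<in> P j \<Longrightarrow> F x \<in> L"
  using return_map_eq return_onto by fastforce

lemma separation_time_step:
  assumes "j \<in> J" "x \<in> P j" "x' \<in> P j"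
  shows "separation_time f J P R x x' = enat (R j) + separation_time f J P R (F x) (F x')"
proof -
  let ?s = "separated f J P R x x'" and ?t = "separated f J P R (F x) (F x')"
  have 0: "\<not> ?s 0" using assms by (auto simp: separated_def)
  have Suc: "?s (Suc l) = ?t l" for l
    by (simp add: separated_def funpow_Suc_right del: funpow.simps)
  have ex: "(\<exists>l. ?s l) = (\<exists>l. ?t l)" using 0 Suc by (metis not0_implies_Suc)
  show ?thesis
  proof (cases "\<exists>l. ?t l")
    case True
    then obtain l where "?t l" by blast
    then have "(LEAST l. ?s l) = Suc (LEAST l. ?t l)"
      using Least_Suc[of ?s "Suc l"] 0 Suc by simp
    then show ?thesis
      using True ex return_time_eq[OF assms(1,2)]
      by (simp add: separation_time_def sum.lessThan_Suc_shift funpow_Suc_right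
          del: funpow.simps sum.lessThan_Suc)
  qed (use ex in \<open>simp add: separation_time_def\<close>)
qed

text \<open>Testing the two shifts by \<open>r\<close> avoids naming end points: by convexity, a
  point of \<open>L\<close> outside this set has its whole \<open>r\<close>-neighbourhood in its
  element. Points of \<open>L\<close> in no element are included, as the return map is not defined
  on them.\<close>

definition near_cut :: "real \<Rightarrow> real set" where
  "near_cut r = L - (\<Union>i\<in>J. {w \<in> P i. w - r \<in> P i \<and> w + r \<in> P i})"

text \<open>Restricting to the union of the elements discards the points where \<open>F\<close> has
  no meaning and gives exactly the preimage in the invariance clause of
  \<open>return_invariant_density\<close>.\<close>

definition pull :: "real set \<Rightarrow> real set" where
  "pull A = {x \<in> (\<Union>j\<in>J. P j). F x \<in> A}"

text \<open>
  A point of \<open>L\<close> outside \<open>slow r n\<close> stays outside \<open>near_cut r\<close> for its first \<open>n\<close> returns.  Up to time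
  \<open>n\<close> there are at most \<open>n\<close> returns, because return times are at least 1.
\<close>

primrec slow :: "real \<Rightarrow> nat \<Rightarrow> real set" where
  "slow r 0 = near_cut r"
| "slow r (Suc n) = near_cut r \<union> pull (slow r n)"

lemma slow_mono: "m \<le> n \<Longrightarrow> slow r m \<subseteq> slow r n"
proof (rule lift_Suc_mono_le[of "slow r"])
  show "slow r n \<subseteq> slow r (Suc n)" for n
    by (induction n) (auto simp: pull_def)
qed

lemma pull_subset: "pull A \<subseteq> L"
  using P_subset by (auto simp: pull_def)

lemma slow_subset: "slow r n \<subseteq> L"
  by (cases n) (use pull_subset in \<open>auto simp: near_cut_def\<close>)

lemma near_cutD:
  assumes "x \<in> L" "x \<notin> near_cut r" "\<bar>x - x'\<bar> \<le> r"
  obtains i where "i \<in> J" "x \<in> P i" "x' \<in> P i"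
proof -
  obtain i where i: "i \<in> J" "x \<in> P i" "x - r \<in> P i" "x + r \<in> P i"
    using assms by (auto simp: near_cut_def)
  moreover have "x - r \<le> x'" "x' \<le> x + r" using assms(3) by auto
  ultimately have "x' \<in> P i" using interval_P[OF i(1)] unfolding is_interval_1 by blast
  then show ?thesis using that i by blast
qed

text \<open>Strong induction on the remaining time \<open>n\<close>. A point of \<open>L\<close> off
  \<open>near_cut r\<close> shares its element with every point within distance \<open>r\<close>, so
  the first return is made together. If it takes more than \<open>n\<close> steps, the claim holds;
  otherwise the time left drops by \<open>R i\<close> while the distance grows at most by the factor
  \<open>B ^ R i\<close>, so the bound by the same \<open>r\<close> persists.\<close>

lemma separation_time_gt:
  assumes "x \<in> L" "x' \<in> L" "x \<notin> slow r n" "B ^ n * \<bar>x - x'\<bar> \<le> r"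
  shows "enat n < separation_time f J P R x' x"
  using assms
proof (induction n arbitrary: x x' rule: less_induct)
  case (less n)
  have "1 \<le> B ^ n" using B_gt_1 by simp
  then have "1 * \<bar>x - x'\<bar> \<le> B ^ n * \<bar>x - x'\<bar>" by (intro mult_right_mono) auto
  also note less.prems(4)
  finally have "\<bar>x - x'\<bar> \<le> r" by simp
  moreover have "x \<notin> near_cut r"
    using less.prems(3) by (cases n) auto
  ultimately obtain i where i: "i \<in> J" "x \<in> P i" "x' \<in> P i"
    using near_cutD less.prems(1) by blast
  note step = separation_time_step[OF i(1,3,2)]
  show ?case
  proof (cases "R i \<le> n")
    case False
    then have "enat n < enat (R i)" by simp
    also have "\<dots> \<le> separation_time f J P R x' x" unfolding step by simp
    finally show ?thesis .
  next
    case True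
    define m where "m = n - R i"
    have m: "m < n" "n = m + R i" using True R_ge_1[OF i(1)] by (auto simp: m_def)
    \<comment> \<open>A return uses up one step of \<open>slow\<close> but \<open>R i\<close> units
      of time, so \<open>m\<close> may be smaller than \<open>n'\<close>; monotonicity of
      \<open>slow\<close> bridges the gap.\<close>
    obtain n' where n': "n = Suc n'" using m(1) by (cases n) simp_all
    have "F x \<notin> slow r n'"
      using less.prems(3) n' i by (auto simp: pull_def)
    then have "F x \<notin> slow r m" using slow_mono[of m n' r] m n' by auto
    moreover have "B ^ m * \<bar>F x - F x'\<bar> \<le> r"
    proof -
      have "\<bar>F x - F x'\<bar> \<le> B ^ R i * \<bar>x - x'\<bar>"
        unfolding return_map_eq[OF i(1,2)] return_map_eq[OF i(1,3)]
        by (rule level_lipschitz[of i 0]) (use i in simp_all)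
      then have "B ^ m * \<bar>F x - F x'\<bar> \<le> B ^ m * (B ^ R i * \<bar>x - x'\<bar>)"
        using B_gt_1 by (intro mult_left_mono) simp_all
      also have "\<dots> = B ^ n * \<bar>x - x'\<bar>" using m(2) by (simp add: power_add)
      finally show ?thesis using less.prems by linarith
    qed
    ultimately have "enat m < separation_time f J P R (F x') (F x)"
      using less.IH[OF m(1)] return_map_in i by blast
    then have "enat (R i) + enat m < separation_time f J P R x' x"
      unfolding step by (cases "separation_time f J P R (F x') (F x)") simp_all
    then show ?thesis using m(2) by (simp add: add.commute)
  qed
qed

text \<open>No separation is counted during the first \<open>R j - k\<close> steps, which lead from
  the level to the base; from there the previous lemma applies with the time that is left. Keeping
  the index \<open>n\<close> in \<open>slow r n\<close> makes the exceptional set the same for all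
  levels.\<close>

lemma level_separation_time_gt:
  assumes j: "j \<in> J" "k < R j" and y: "y \<in> (f ^^ k) ` P j" "y' \<in> (f ^^ k) ` P j"
    and r: "B ^ n * \<bar>y - y'\<bar> \<le> r"
    and fast: "n < R j - k \<or> (f ^^ (R j - k)) y \<notin> slow r n"
  shows "enat n < level_separation_time f J P R j k y' y"
proof (cases "n < R j - k")
  case True
  then have "enat n < enat (R j - k)" by simp
  also have "\<dots> \<le> level_separation_time f J P R j k y' y"
    by (simp add: level_separation_time_def)
  finally show ?thesis .
next
  case False
  let ?g = "f ^^ (R j - k)"
  have L: "?g z \<in> L" if z: "z \<in> (f ^^ k) ` P j" for z
  proof -
    obtain x where "x \<in> P j" "z = (f ^^ k) x" using z by blast
    then have "?g z = (f ^^ R j) x" using funpow_add_apply[of "R j - k" k f x] j by simp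
    then show ?thesis using return_onto[OF j(1)] \<open>x \<in> P j\<close> by blast
  qed
  define m where "m = n - (R j - k)"
  have m: "n = m + (R j - k)" "m \<le> n" using False by (auto simp: m_def)
  have "\<bar>?g y - ?g y'\<bar> \<le> B ^ (R j - k) * \<bar>y - y'\<bar>"
    by (rule level_lipschitz[of j k]) (use j y in simp_all)
  then have "B ^ m * \<bar>?g y - ?g y'\<bar> \<le> B ^ m * (B ^ (R j - k) * \<bar>y - y'\<bar>)"
    using B_gt_1 by (intro mult_left_mono) simp_all
  also have "\<dots> = B ^ n * \<bar>y - y'\<bar>" using m by (simp add: power_add)
  finally have "B ^ m * \<bar>?g y - ?g y'\<bar> \<le> r" using r by linarith
  moreover have "?g y \<notin> slow r m" using fast False slow_mono[OF m(2)] by blast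
  ultimately have "enat m < separation_time f J P R (?g y') (?g y)"
    using separation_time_gt L y by blast
  then have "enat (R j - k) + enat m < level_separation_time f J P R j k y' y"
    unfolding level_separation_time_def
    by (cases "separation_time f J P R (?g y') (?g y)") simp_all
  then show ?thesis using m(1) by (simp add: add.commute)
qed

section \<open>Measurability and size of the neighbourhoods of the cuts\<close>

lemma borel_pull:
  assumes A: "A \<in> sets borel"
  shows "pull A \<in> sets borel"
proof -
  have "pull A = (\<Union>j\<in>J. (f ^^ R j) -` A \<inter> P j)"
    using return_map_eq by (fastforce simp: pull_def)
  moreover have "(f ^^ R j) -` A \<inter> P j \<in> sets borel" if j: "j \<in> J" for j
  proof -
    \<comment> \<open>Continuity pulls back Borel sets to Borel sets, and the invariance hypothesis
      is stated for Borel sets; hence \<open>borel\<close> rather than \<open>lebesgue\<close> for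
      \<open>pull\<close> and \<open>slow\<close>.\<close>
    have "(f ^^ R j) \<in> borel_measurable (restrict_space borel (P j))"
      by (intro borel_measurable_continuous_on_restrict level_continuous j order_refl)
    from measurable_sets[OF this A] show ?thesis
      using P_sets(2)[OF j] by (simp add: sets_restrict_space_iff space_restrict_space)
  qed
  ultimately show ?thesis by (auto intro: sets.countable_UN')
qed

lemma borel_near_cut: "near_cut r \<in> sets borel"
proof -
  have "{w \<in> P i. w - r \<in> P i \<and> w + r \<in> P i} \<in> sets borel" if "i \<in> J" for i
  proof -
    have [measurable]: "P i \<in> sets borel" using P_sets that by blast
    show ?thesis by measurable
  qed
  then show ?thesis
    unfolding near_cut_def using L_sets by (intro sets.Diff sets.countable_UN') auto
qed

lemma borel_slow: "slow r n \<in> sets borel"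
  by (induction n) (simp_all add: borel_near_cut borel_pull sets.Un)

text \<open>In each element the points to be counted lie in two end layers of width at most
  \<open>r\<close>, which gives \<open>2 * r\<close>, and they never exceed the element itself. The
  rest of \<open>near_cut r\<close> is null.\<close>

lemma emeasure_near_cut:
  assumes "0 \<le> r"
  shows "emeasure lebesgue (near_cut r)
    \<le> (\<Sum>j. if j \<in> J then ennreal (min (2 * r) (measure lebesgue (P j))) else 0)"
proof -
  let ?N = "\<lambda>j. if j \<in> J then P j - {w \<in> P j. w - r \<in> P j \<and> w + r \<in> P j} else {}"
  have N_sets: "?N j \<in> sets lebesgue" for j
  proof (cases "j \<in> J")
    case True
    then have [measurable]: "P j \<in> sets borel" using P_sets by blast
    have "P j - {w \<in> P j. w - r \<in> P j \<and> w + r \<in> P j} \<in> sets borel" by measurable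
    then show ?thesis using True by auto
  qed simp
  have UN_sets: "(\<Union>j. ?N j) \<in> sets lebesgue"
    by (intro sets.countable_UN) (use N_sets in blast)
  have "near_cut r \<subseteq> (L - (\<Union>j\<in>J. P j)) \<union> (\<Union>j. ?N j)"
    by (auto simp: near_cut_def)
  moreover have meas: "L - (\<Union>j\<in>J. P j) \<in> sets lebesgue"
    using L_sets P_sets by (intro sets.Diff sets.countable_UN') auto
  ultimately have "emeasure lebesgue (near_cut r) \<le>
      emeasure lebesgue ((L - (\<Union>j\<in>J. P j)) \<union> (\<Union>j. ?N j))"
    using sets.Un[OF meas UN_sets] by (intro emeasure_mono)
  also have "\<dots> \<le> emeasure lebesgue (L - (\<Union>j\<in>J. P j)) + emeasure lebesgue (\<Union>j. ?N j)"
    using meas UN_sets by (intro emeasure_subadditive)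
  also have "\<dots> \<le> 0 + (\<Sum>j. emeasure lebesgue (?N j))"
    using null_complement N_sets by (intro add_mono emeasure_subadditive_countably) (simp, blast)
  also have "0 + (\<Sum>j. emeasure lebesgue (?N j)) \<le>
      (\<Sum>j. if j \<in> J then ennreal (min (2 * r) (measure lebesgue (P j))) else 0)"
    unfolding add_0
  proof (intro suminf_le summableI)
    fix j
    show "emeasure lebesgue (?N j) \<le> (if j \<in> J then ennreal (min (2 * r) (measure lebesgue (P j))) else 0)"
    proof (cases "j \<in> J")
      case True
      have [measurable]: "P j \<in> sets borel" using P_sets True by blast
      have b: "bounded (P j)" using bounded_L P_subset[OF True] by (rule bounded_subset)
      have sub: "?N j \<subseteq> {y \<in> P j. y - r \<notin> P j} \<union> {y \<in> P j. y - (- r) \<notin> P j}"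
        using True by auto
      have "{y \<in> P j. y - r \<notin> P j} \<in> sets borel" "{y \<in> P j. y - (- r) \<notin> P j} \<in> sets borel"
        by measurable
      then have "emeasure lebesgue (?N j) \<le>
          emeasure lebesgue {y \<in> P j. y - r \<notin> P j} + emeasure lebesgue {y \<in> P j. y - (- r) \<notin> P j}"
        by (intro order_trans[OF emeasure_mono[OF sub]] emeasure_subadditive) auto
      also have "\<dots> \<le> ennreal \<bar>r\<bar> + ennreal \<bar>- r\<bar>"
        by (intro add_mono measure_interval_diff_translate interval_P True b)
      also have "\<dots> = ennreal (2 * r)"
        using assms by (simp flip: ennreal_plus)
      finally have "emeasure lebesgue (?N j) \<le> ennreal (2 * r)" .
      moreover have "emeasure lebesgue (?N j) \<le> ennreal (measure lebesgue (P j))"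
        using P_sets[OF True] True
        by (subst emeasure_eq_measure2[symmetric]) (auto intro!: emeasure_mono)
      ultimately show ?thesis using True by (simp add: min_def)
    qed simp
  qed
  finally show ?thesis .
qed

end

section \<open>Modulus of continuity of a single coefficient\<close>

text \<open>\<open>D\<close>, \<open>K\<close> and \<open>M\<close> name the constants of the
  regularity, mass and density bounds, which the theorem provides only as existential
  statements.\<close>

locale tower_density = markov_tower +
  fixes \<phi> :: "real \<Rightarrow> real" and \<alpha> D K M :: real
  assumes phi: "return_invariant_density f L J P R \<phi>"
    and alpha: "0 < \<alpha>" "\<alpha> < 1"
    and D_pos: "0 < D" and K_pos: "0 < K" and M_pos: "0 < M"
    and coeff_ratio: "\<And>j k y y'. j \<in> J \<Longrightarrow> k < R j \<Longrightarrow> y \<in> (f ^^ k) ` P j \<Longrightarrow> y' \<in> (f ^^ k) ` P j \<Longrightarrow>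
      \<bar>tower_coeff f P \<phi> k j y / tower_coeff f P \<phi> k j y' - 1\<bar>
        \<le> D * enat_power \<alpha> (level_separation_time f J P R j k y y')"
    and coeff_lower: "\<And>j k y. j \<in> J \<Longrightarrow> k < R j \<Longrightarrow> y \<in> (f ^^ k) ` P j \<Longrightarrow>
      inverse K * measure lebesgue (P j) \<le> tower_coeff f P \<phi> k j y * measure lebesgue ((f ^^ k) ` P j)"
    and coeff_upper: "\<And>j k y. j \<in> J \<Longrightarrow> k < R j \<Longrightarrow> y \<in> (f ^^ k) ` P j \<Longrightarrow>
      tower_coeff f P \<phi> k j y * measure lebesgue ((f ^^ k) ` P j) \<le> K * measure lebesgue (P j)"
    and coeff_bound: "\<And>j k y. j \<in> J \<Longrightarrow> k < R j \<Longrightarrow> y \<in> (f ^^ k) ` P j \<Longrightarrow>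
      tower_coeff f P \<phi> k j y \<le> M * B ^ (R j - k) * measure lebesgue (P j) / measure lebesgue L"
begin

abbreviation "b \<equiv> \<lambda>j k. tower_coeff f P \<phi> k j"

section \<open>Positivity and pointwise bounds of the coefficients\<close>

lemma P_pos: "j \<in> J \<Longrightarrow> 0 < measure lebesgue (P j)"
  using measure_P_lower[of j] L_pos B_gt_1
  by (metis less_le_not_le measure_nonneg mult_zero_right order_le_less order_trans)

text \<open>The lower mass bound makes the product with the length of the level positive, and that
  length is nonnegative. Positivity is what gives the quotients in \<open>coeff_ratio\<close> their
  meaning.\<close>

lemma b_pos:
  assumes "j \<in> J" "k < R j" "y \<in> (f ^^ k) ` P j"
  shows "0 < b j k y"
proof -
  have "0 < inverse K * measure lebesgue (P j)" using K_pos P_pos[OF assms(1)] by simp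
  also note coeff_lower[OF assms]
  finally show ?thesis
    by (metis measure_nonneg order_le_less zero_less_mult_pos2 mult_zero_right less_irrefl)
qed

lemma b_outside: "y \<notin> (f ^^ k) ` P j \<Longrightarrow> b j k y = 0"
  by (simp add: tower_coeff_def)

lemma b_nonneg: "j \<in> J \<Longrightarrow> k < R j \<Longrightarrow> 0 \<le> b j k y"
  using b_pos[of j k y] b_outside[of y k j] by force

lemma b_level:
  assumes j: "j \<in> J" "k < R j" and x: "x \<in> P j"
    and d: "((f ^^ k) has_real_derivative d) (at x within P j)"
  shows "b j k ((f ^^ k) x) = \<phi> x / \<bar>d\<bar>"
proof -
  have inv: "inv_into (P j) (f ^^ k) ((f ^^ k) x) = x"
    using level_inj[of j k] j x by (simp add: inv_into_f_f)
  have "at x within P j \<noteq> bot" using level_not_trivial_limit[of j 0 x] j x by simp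
  then have "vector_derivative (f ^^ k) (at x within P j) = d"
    using d unfolding has_real_derivative_iff_has_vector_derivative by (rule vector_derivative_within)
  then show ?thesis using x inv by (simp add: tower_coeff_def)
qed

lemma phi_eq: 
  assumes "j \<in> J" "x \<in> P j"
  shows "b j 0 x = \<phi> x"
proof -
  have "0 < R j" using R_ge_1[OF assms(1)] by simp
  from b_level[OF assms(1) this assms(2), of 1] show ?thesis by (simp add: id_def)
qed

lemma phi_pos: "j \<in> J \<Longrightarrow> x \<in> P j \<Longrightarrow> 0 < \<phi> x"
  using b_pos[of j 0 x] phi_eq[of j x] R_ge_1[of j] by simp

text \<open>\<open>return_invariant_density\<close> bounds \<open>\<phi>\<close> only almost
  everywhere. At level 0 the coefficient is \<open>\<phi>\<close> itself and the length of
  \<open>P j\<close> cancels, which gives a bound at every point of every element.\<close>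

lemma phi_le: "j \<in> J \<Longrightarrow> x \<in> P j \<Longrightarrow> \<phi> x \<le> K"
  using coeff_upper[of j 0 x] phi_eq[of j x] R_ge_1[of j] P_pos[of j] by simp

section \<open>The invariant measure on subsets of \<open>L\<close>\<close>

definition nu :: "real set \<Rightarrow> ennreal" where
  "nu A = (\<integral>\<^sup>+x\<in>A. ennreal (\<phi> x) \<partial>lebesgue)"

lemma phi_measurable: "T \<in> sets lebesgue \<Longrightarrow> T \<subseteq> L \<Longrightarrow> \<phi> \<in> borel_measurable (lebesgue_on T)"
  using phi measurable_restrict_mono unfolding return_invariant_density_def by blast

lemma phi_measurable': "T \<in> sets lebesgue \<Longrightarrow> T \<subseteq> L \<Longrightarrow> (\<lambda>x. ennreal (\<phi> x) * indicator T x) \<in> borel_measurable lebesgue"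
proof -
  assume T: "T \<in> sets lebesgue" "T \<subseteq> L"
  have "(\<lambda>x. indicator T x *\<^sub>R \<phi> x) \<in> borel_measurable lebesgue"
    using phi_measurable[OF T] T by (subst (asm) borel_measurable_restrict_space_iff) simp_all
  then have "(\<lambda>x. ennreal (indicator T x *\<^sub>R \<phi> x)) \<in> borel_measurable lebesgue" by simp
  then show ?thesis
    by (rule measurable_cong[THEN iffD1, rotated]) (simp split: split_indicator)
qed

text \<open>\<open>nu\<close> integrates over \<open>lebesgue\<close>, which suits the change of
  variables; for measurable subsets of \<open>L\<close> it agrees with the measure whose invariance
  is assumed.\<close>

lemma nu_eq_emeasure:
  assumes "A \<in> sets lebesgue" "A \<subseteq> L"
  shows "nu A = emeasure (density (lebesgue_on L) (\<lambda>x. ennreal (\<phi> x))) A"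
proof -
  have "\<phi> \<in> borel_measurable (lebesgue_on L)"
    using phi by (simp add: return_invariant_density_def)
  moreover have "A \<in> sets (lebesgue_on L)"
    using assms L_sets by (simp add: sets_restrict_space_iff)
  ultimately have "emeasure (density (lebesgue_on L) (\<lambda>x. ennreal (\<phi> x))) A =
      (\<integral>\<^sup>+x\<in>A. ennreal (\<phi> x) \<partial>lebesgue_on L)"
    by (subst emeasure_density) simp_all
  also have "\<dots> = (\<integral>\<^sup>+x. ennreal (\<phi> x) * indicator A x * indicator L x \<partial>lebesgue)"
    using L_sets by (subst nn_integral_restrict_space) simp_all
  also have "\<dots> = nu A"
    unfolding nu_def using assms by (intro nn_integral_cong) (auto split: split_indicator)
  finally show ?thesis by simp
qed

lemma nu_pull:
  assumes A: "A \<in> sets borel" "A \<subseteq> L"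
  shows "nu (pull A) = nu A"
proof -
  have "nu (pull A) = emeasure (density (lebesgue_on L) (\<lambda>x. ennreal (\<phi> x))) (pull A)"
    using borel_pull[OF A(1)] pull_subset by (intro nu_eq_emeasure) auto
  also have "\<dots> = emeasure (density (lebesgue_on L) (\<lambda>x. ennreal (\<phi> x))) (A \<inter> L)"
    using phi A(1) by (simp add: return_invariant_density_def Let_def pull_def)
  also have "\<dots> = nu A"
    using A by (subst nu_eq_emeasure) (auto simp: Int_absorb2)
  finally show ?thesis .
qed

lemma nu_Un_le:
  assumes "A \<in> sets borel" "A \<subseteq> L" "A' \<in> sets borel" "A' \<subseteq> L"
  shows "nu (A \<union> A') \<le> nu A + nu A'"
  using assms L_sets
  by (subst (1 2 3) nu_eq_emeasure) (auto intro!: emeasure_subadditive simp: sets_restrict_space_iff)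

text \<open>\<open>slow r n\<close> is the union of the iterated preimages of
  \<open>near_cut r\<close> at the returns 0 to \<open>n\<close>, and by invariance all of them have
  the same measure.\<close>

lemma nu_slow: "nu (slow r n) \<le> of_nat (Suc n) * nu (near_cut r)"
proof (induction n)
  case (Suc n)
  have "nu (slow r (Suc n)) \<le> nu (near_cut r) + nu (pull (slow r n))"
    unfolding slow.simps
    by (intro nu_Un_le borel_near_cut borel_pull borel_slow pull_subset) (auto simp: near_cut_def)
  also have "\<dots> \<le> nu (near_cut r) + of_nat (Suc n) * nu (near_cut r)"
    using Suc nu_pull[OF borel_slow slow_subset] by (simp add: add_left_mono)
  finally show ?case by (simp add: algebra_simps)
qed simp

lemma nu_le: 
  assumes "A \<in> sets lebesgue" "A \<subseteq> L"
  shows "nu A \<le> ennreal K * emeasure lebesgue A"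
proof -
  have "L - (\<Union>j\<in>J. P j) \<in> sets lebesgue"
    using L_sets P_sets by (intro sets.Diff sets.countable_UN') auto
  then have "L - (\<Union>j\<in>J. P j) \<in> null_sets lebesgue" using null_complement by (simp add: null_sets_def)
  then have "AE x in lebesgue. x \<notin> L - (\<Union>j\<in>J. P j)" by (rule AE_not_in)
  then have "AE x in lebesgue. ennreal (\<phi> x) * indicator A x \<le> ennreal K * indicator A x"
    by (rule AE_mp) (use assms phi_le in \<open>auto intro!: AE_I2 ennreal_leI split: split_indicator\<close>)
  then have "nu A \<le> (\<integral>\<^sup>+x. ennreal K * indicator A x \<partial>lebesgue)"
    unfolding nu_def by (rule nn_integral_mono_AE)
  also have "\<dots> = ennreal K * emeasure lebesgue A"
    using assms by (simp add: nn_integral_cmult_indicator)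
  finally show ?thesis .
qed

lemma nu_P_le: "j \<in> J \<Longrightarrow> nu (P j) \<le> ennreal (K * measure lebesgue (P j))"
  using nu_le[of "P j"] P_sets[of j] P_subset[of j] K_pos
  by (simp add: emeasure_eq_measure2 ennreal_mult)

text \<open>The measure \<open>b j k y dy\<close> is the image under \<open>f ^^ k\<close> of \<open>\<phi> dx\<close> restricted to \<open>P j\<close>.\<close>

lemma change_variables:
  assumes j: "j \<in> J" "k < R j" and T: "T \<in> sets lebesgue" "T \<subseteq> P j"
  shows "(\<lambda>y. indicator ((f ^^ k) ` T) y * b j k y) \<in> borel_measurable lebesgue"
    and "(\<integral>\<^sup>+y\<in>(f ^^ k) ` T. ennreal (b j k y) \<partial>lebesgue) = nu T"
proof -
  obtain g' where g': "\<And>x. x \<in> P j \<Longrightarrow> ((f ^^ k) has_real_derivative g' x) (at x within P j)"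
    using level_C1[of j k] j by (metis less_imp_le)
  have TL: "T \<subseteq> L" using T P_subset[OF j(1)] by simp
  \<comment> \<open>A vanishing derivative is excluded because division by 0 would make the
    coefficient 0, contrary to \<open>b_pos\<close>.\<close>
  have eq: "\<bar>g' x\<bar> * b j k ((f ^^ k) x) = \<phi> x" if "x \<in> T" for x
  proof -
    have x: "x \<in> P j" using that T by auto
    have "b j k ((f ^^ k) x) > 0" using b_pos[OF j] x by blast
    then show ?thesis using b_level[OF j x g'[OF x]] by auto
  qed
  have bound: "\<bar>\<phi> x\<bar> \<le> K" if "x \<in> T" for x
    using phi_pos[OF j(1), of x] phi_le[OF j(1), of x] that T by auto
  have "T \<in> lmeasurable" using T P_sets[OF j(1)] by (meson fmeasurableI2)
  then have int\<phi>: "\<phi> absolutely_integrable_on T"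
    using bound phi_measurable[OF T(1) TL] T
    by (intro measurable_bounded_by_integrable_imp_absolutely_integrable[of _ _ "\<lambda>_. K"])
       (auto simp: integrable_on_const)
  moreover have "(\<lambda>x. \<bar>g' x\<bar> * b j k ((f ^^ k) x)) absolutely_integrable_on T \<longleftrightarrow> \<phi> absolutely_integrable_on T"
    using eq by (intro set_integrable_cong) auto
  moreover have "integral T (\<lambda>x. \<bar>g' x\<bar> * b j k ((f ^^ k) x)) = integral T \<phi>"
    using eq by (intro integral_cong) auto
  ultimately have cv: "b j k absolutely_integrable_on (f ^^ k) ` T"
      "integral ((f ^^ k) ` T) (b j k) = integral T \<phi>"
    using has_absolute_integral_change_of_variables_1'[of T "f ^^ k" g' "b j k" "integral T \<phi>"]
      T g' level_inj[of j k] j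
    by (auto intro: DERIV_subset inj_on_subset)
  then show "(\<lambda>y. indicator ((f ^^ k) ` T) y * b j k y) \<in> borel_measurable lebesgue"
    by (simp add: set_integrable_def)
  have "(\<integral>\<^sup>+y\<in>(f ^^ k) ` T. ennreal (b j k y) \<partial>lebesgue) =
      (\<integral>\<^sup>+y. ennreal (indicator ((f ^^ k) ` T) y *\<^sub>R b j k y) \<partial>lebesgue)"
    by (intro nn_integral_cong) (simp split: split_indicator)
  also have "\<dots> = ennreal (LINT y:(f ^^ k) ` T|lebesgue. b j k y)"
    unfolding set_lebesgue_integral_def
    using cv(1) b_nonneg[OF j] by (intro nn_integral_eq_integral) (auto simp: set_integrable_def)
  also have "\<dots> = ennreal (LINT x:T|lebesgue. \<phi> x)"
    using cv int\<phi> by (simp add: set_lebesgue_integral_eq_integral)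
  also have "\<dots> = (\<integral>\<^sup>+x. ennreal (indicator T x *\<^sub>R \<phi> x) \<partial>lebesgue)"
    unfolding set_lebesgue_integral_def
    using int\<phi> phi_pos[OF j(1)] T
    by (intro nn_integral_eq_integral[symmetric])
       (auto simp: set_integrable_def intro!: AE_I2 less_imp_le split: split_indicator)
  also have "\<dots> = nu T"
    unfolding nu_def by (intro nn_integral_cong) (simp split: split_indicator)
  finally show "(\<integral>\<^sup>+y\<in>(f ^^ k) ` T. ennreal (b j k y) \<partial>lebesgue) = nu T" .
qed

lemma b_measurable:
  assumes "j \<in> J" "k < R j"
  shows "b j k \<in> borel_measurable lebesgue"
proof -
  have "(\<lambda>y. indicator ((f ^^ k) ` P j) y * b j k y) = b j k"
    by (rule ext) (simp add: b_outside split: split_indicator)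
  then show ?thesis using change_variables(1)[OF assms P_sets(1)[OF assms(1)] order_refl] by simp
qed

lemma nn_integral_b:
  assumes "j \<in> J" "k < R j"
  shows "(\<integral>\<^sup>+y. ennreal (b j k y) \<partial>lebesgue) = nu (P j)"
proof -
  have "(\<integral>\<^sup>+y. ennreal (b j k y) \<partial>lebesgue) = (\<integral>\<^sup>+y\<in>(f ^^ k) ` P j. ennreal (b j k y) \<partial>lebesgue)"
    using b_outside by (intro nn_integral_cong) (auto simp: indicator_def)
  then show ?thesis using change_variables(2)[OF assms P_sets(1)[OF assms(1)] order_refl] by simp
qed

text \<open>One constant for both regimes of \<open>edge_integral\<close>: \<open>K\<close> from the
  total mass, the other entry from the density bound.\<close>

definition W where "W = max K (M / measure lebesgue L)"

lemma W_pos: "0 < W" using K_pos by (simp add: W_def)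

text \<open>The first case uses the total mass of the level, the second one the bound on its density.\<close>

lemma edge_integral:
  assumes j: "j \<in> J" "k < R j" and t: "0 < t" "t \<le> 1"
  shows "(\<integral>\<^sup>+y\<in>{y \<in> (f ^^ k) ` P j. y - e \<notin> (f ^^ k) ` P j}. ennreal (b j k y) \<partial>lebesgue)
    \<le> ennreal (W * measure lebesgue (P j) * (B ^ R j * \<bar>e\<bar>) powr t)"
proof (cases "1 \<le> B ^ R j * \<bar>e\<bar>")
  case True
  have "(\<integral>\<^sup>+y\<in>{y \<in> (f ^^ k) ` P j. y - e \<notin> (f ^^ k) ` P j}. ennreal (b j k y) \<partial>lebesgue)
      \<le> (\<integral>\<^sup>+y. ennreal (b j k y) \<partial>lebesgue)"
    by (intro nn_integral_mono) (simp split: split_indicator)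
  also have "\<dots> \<le> ennreal (K * measure lebesgue (P j))"
    using nn_integral_b[OF j] nu_P_le[OF j(1)] by simp
  also have "\<dots> \<le> ennreal (W * measure lebesgue (P j) * (B ^ R j * \<bar>e\<bar>) powr t)"
  proof (intro ennreal_leI)
    have "K * measure lebesgue (P j) * 1 \<le> W * measure lebesgue (P j) * (B ^ R j * \<bar>e\<bar>) powr t"
      using True t K_pos W_pos by (intro mult_mono ge_one_powr_ge_zero) (auto simp: W_def)
    then show "K * measure lebesgue (P j) \<le> W * measure lebesgue (P j) * (B ^ R j * \<bar>e\<bar>) powr t" by simp
  qed
  finally show ?thesis .
next
  case False
  let ?S = "(f ^^ k) ` P j" and ?c = "M * B ^ R j * measure lebesgue (P j) / measure lebesgue L"
  have [measurable]: "?S \<in> sets borel" using level_sets[of j k] j by simp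
  have N: "{y \<in> ?S. y - e \<notin> ?S} \<in> sets lebesgue"
    by (intro sets_completionI_sets) (simp, measurable)
  \<comment> \<open>Enlarging \<open>R j - k\<close> to \<open>R j\<close> makes the bound uniform
    over the levels of an element.\<close>
  have c: "b j k y \<le> ?c" if "y \<in> ?S" for y
  proof -
    have "B ^ (R j - k) \<le> B ^ R j" using B_gt_1 by (intro power_increasing) auto
    then have "M * B ^ (R j - k) * measure lebesgue (P j) / measure lebesgue L \<le> ?c"
      using M_pos by (intro divide_right_mono mult_right_mono mult_left_mono) auto
    then show ?thesis using coeff_bound[OF j that] by simp
  qed
  have c0: "0 \<le> ?c" using M_pos B_gt_1 by simp
  have "(\<integral>\<^sup>+y\<in>{y \<in> ?S. y - e \<notin> ?S}. ennreal (b j k y) \<partial>lebesgue) \<le>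
      (\<integral>\<^sup>+y. ennreal ?c * indicator {y \<in> ?S. y - e \<notin> ?S} y \<partial>lebesgue)"
    using c by (intro nn_integral_mono) (auto split: split_indicator intro: ennreal_leI)
  also have "\<dots> = ennreal ?c * emeasure lebesgue {y \<in> ?S. y - e \<notin> ?S}"
    using N by (simp add: nn_integral_cmult_indicator)
  also have "\<dots> \<le> ennreal ?c * ennreal \<bar>e\<bar>"
    using j by (intro mult_left_mono measure_interval_diff_translate level_interval level_bounded) auto
  also have "\<dots> = ennreal (M / measure lebesgue L * measure lebesgue (P j) * (B ^ R j * \<bar>e\<bar>))"
    using c0 by (simp add: mult_ac flip: ennreal_mult)
  also have "\<dots> \<le> ennreal (W * measure lebesgue (P j) * (B ^ R j * \<bar>e\<bar>) powr t)"
    using False t M_pos K_pos L_pos B_gt_1 min_one_le_powr[of "B ^ R j * \<bar>e\<bar>" t]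
    by (intro ennreal_leI mult_mono) (auto simp: W_def max_def)
  finally show ?thesis .
qed

section \<open>Oscillation inside a level and the modulus of one coefficient\<close>

lemma enat_power_le: "enat n < s \<Longrightarrow> enat_power \<alpha> s \<le> \<alpha> ^ n"
  using alpha by (cases s) (auto simp: enat_power_def intro!: power_decreasing)

lemma enat_power_le_1: "enat_power \<alpha> s \<le> 1"
  using alpha by (cases s) (auto simp: enat_power_def power_le_one)

text \<open>Multiplying the ratio estimate by \<open>b j k y\<close> turns it into an oscillation
  bound. A long separation time yields \<open>\<alpha> ^ n\<close>. Otherwise only the factor 1
  remains, but then the point of \<open>P j\<close> below \<open>y\<close> lies in
  \<open>pull (slow r n)\<close>, and the return has come within \<open>n\<close> steps.\<close>

lemma interior_oscillation:
  assumes j: "j \<in> J" "k < R j" and y: "y \<in> (f ^^ k) ` P j" "y' \<in> (f ^^ k) ` P j"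
    and r: "B ^ n * \<bar>y - y'\<bar> \<le> r"
  shows "\<bar>b j k y - b j k y'\<bar> \<le> D * \<alpha> ^ n * b j k y +
      (if R j - k \<le> n then D * (b j k y * indicator ((f ^^ k) ` (P j \<inter> pull (slow r n))) y) else 0)"
proof -
  let ?s = "level_separation_time f J P R j k y' y"
  have pos: "0 < b j k y" using b_pos[OF j y(1)] .
  have "\<bar>b j k y - b j k y'\<bar> = b j k y * \<bar>b j k y' / b j k y - 1\<bar>"
    using pos by (simp add: abs_mult_pos' field_simps abs_minus_commute)
  also have "\<dots> \<le> b j k y * (D * enat_power \<alpha> ?s)"
    using coeff_ratio[OF j y(2,1)] pos by (intro mult_left_mono) auto
  finally have *: "\<bar>b j k y - b j k y'\<bar> \<le> D * enat_power \<alpha> ?s * b j k y" by (simp add: mult_ac)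
  show ?thesis
  proof (cases "n < R j - k \<or> (f ^^ (R j - k)) y \<notin> slow r n")
    case True
    have "enat n < ?s" by (rule level_separation_time_gt[OF j y r True])
    then have "D * enat_power \<alpha> ?s * b j k y \<le> D * \<alpha> ^ n * b j k y"
      using enat_power_le D_pos pos by (intro mult_right_mono mult_left_mono) auto
    moreover have "0 \<le> D * (b j k y * indicator ((f ^^ k) ` (P j \<inter> pull (slow r n))) y)"
      using D_pos pos by simp
    ultimately show ?thesis using * by auto
  next
    case False
    obtain x where x: "x \<in> P j" "y = (f ^^ k) x" using y by blast
    have "(f ^^ (R j - k)) y = F x"
      using funpow_add_apply[of "R j - k" k f x] j return_map_eq[OF j(1) x(1)] x(2) by simp
    then have "x \<in> P j \<inter> pull (slow r n)" using False x(1) j by (auto simp: pull_def)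
    then have "indicator ((f ^^ k) ` (P j \<inter> pull (slow r n))) y = (1::real)"
      using x(2) by (auto simp del: funpow.simps)
    moreover have "D * enat_power \<alpha> ?s * b j k y \<le> D * 1 * b j k y"
      using enat_power_le_1 D_pos pos by (intro mult_right_mono mult_left_mono) auto
    moreover have "0 \<le> D * \<alpha> ^ n * b j k y" using D_pos pos alpha by simp
    ultimately show ?thesis using * False by auto
  qed
qed

text \<open>The line splits according to which of \<open>y\<close> and \<open>y - d\<close> lie in
  the level. Exactly one of them gives an edge term, once for each side; both give the oscillation
  bound; neither gives 0.\<close>

lemma coeff_modulus:
  assumes j: "j \<in> J" "k < R j" and t: "0 < t" "t \<le> 1" and r: "B ^ n * \<bar>d\<bar> \<le> r"
  shows "(\<integral>\<^sup>+y. ennreal \<bar>b j k y - b j k (y - d)\<bar> \<partial>lebesgue) \<le>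
    ennreal (2 * (W * measure lebesgue (P j) * (B ^ R j * \<bar>d\<bar>) powr t))
    + ennreal (D * \<alpha> ^ n * (K * measure lebesgue (P j)))
    + (if R j - k \<le> n then ennreal D * nu (P j \<inter> pull (slow r n)) else 0)"
proof -
  let ?S = "(f ^^ k) ` P j" and ?T = "P j \<inter> pull (slow r n)"
  let ?E = "\<lambda>e. {y \<in> ?S. y - e \<notin> ?S}"
  define c where "c = (if R j - k \<le> n then ennreal D else 0)"
  have T: "?T \<in> sets lebesgue" "?T \<subseteq> P j"
    using P_sets[OF j(1)] borel_pull[OF borel_slow] by auto
  have mb[measurable]: "b j k \<in> borel_measurable lebesgue" by (rule b_measurable[OF j])
  have Sb[measurable]: "?S \<in> sets borel" using level_sets[of j k] j by simp
  have mE: "?E e \<in> sets lebesgue" for e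
    by (intro sets_completionI_sets) (simp, measurable)
  have mE1[measurable]: "(\<lambda>y. ennreal (b j k y) * indicator (?E e) y) \<in> borel_measurable lebesgue" for e
    using mE[of e] by measurable
  \<comment> \<open>When \<open>y - d\<close> is in the level and \<open>y\<close> is not, the edge
    set is that of the opposite shift, evaluated at \<open>y - d\<close>.\<close>
  have mE2: "(\<lambda>y. ennreal (b j k (y - d)) * indicator (?E (- d)) (y - d)) \<in> borel_measurable lebesgue"
    using measurable_compose[OF measurable_translate mE1[of "- d"]] by simp
  have mT: "(\<lambda>y. ennreal (b j k y) * indicator ((f ^^ k) ` ?T) y) \<in> borel_measurable lebesgue"
  proof -
    have "(\<lambda>y. ennreal (indicator ((f ^^ k) ` ?T) y * b j k y)) \<in> borel_measurable lebesgue"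
      using change_variables(1)[OF j T] by simp
    then show ?thesis
      by (rule measurable_cong[THEN iffD1, rotated]) (simp split: split_indicator)
  qed
  have pt: "ennreal \<bar>b j k y - b j k (y - d)\<bar> \<le>
      ennreal (b j k y) * indicator (?E d) y + ennreal (b j k (y - d)) * indicator (?E (- d)) (y - d)
      + (ennreal (D * \<alpha> ^ n) * ennreal (b j k y)
      + c * (ennreal (b j k y) * indicator ((f ^^ k) ` ?T) y))" for y
  proof -
    consider "y \<in> ?S" "y - d \<in> ?S" | "y \<in> ?S" "y - d \<notin> ?S" | "y \<notin> ?S" "y - d \<in> ?S" | "y \<notin> ?S" "y - d \<notin> ?S"
      by blast
    then show ?thesis
    proof cases
      case 1
      have n0: "0 \<le> b j k y" by (rule b_nonneg[OF j])
      have "\<bar>b j k y - b j k (y - d)\<bar> \<le> D * \<alpha> ^ n * b j k y +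
          (if R j - k \<le> n then D * (b j k y * indicator ((f ^^ k) ` ?T) y) else 0)"
        using r by (intro interior_oscillation j 1) simp
      then have "ennreal \<bar>b j k y - b j k (y - d)\<bar> \<le> ennreal (D * \<alpha> ^ n * b j k y +
          (if R j - k \<le> n then D * (b j k y * indicator ((f ^^ k) ` ?T) y) else 0))"
        by (rule ennreal_leI)
      also have "\<dots> = ennreal (D * \<alpha> ^ n) * ennreal (b j k y)
          + c * (ennreal (b j k y) * indicator ((f ^^ k) ` ?T) y)"
        using n0 D_pos alpha
        by (auto simp: c_def ennreal_plus ennreal_mult split: split_indicator)
      finally show ?thesis by (rule order_trans) (rule add_increasing, simp_all)
    next
      case 2
      have "0 \<le> b j k y" by (rule b_nonneg[OF j])
      then show ?thesis using 2 b_outside[OF 2(2)] by (simp add: add.assoc)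
    next
      case 3
      have "0 \<le> b j k (y - d)" by (rule b_nonneg[OF j])
      then show ?thesis using 3 b_outside[OF 3(1)] by simp
    next
      case 4
      then show ?thesis using b_outside by simp
    qed
  qed
  have "(\<integral>\<^sup>+y. ennreal \<bar>b j k y - b j k (y - d)\<bar> \<partial>lebesgue) \<le>
      (\<integral>\<^sup>+y. ennreal (b j k y) * indicator (?E d) y + ennreal (b j k (y - d)) * indicator (?E (- d)) (y - d)
      + (ennreal (D * \<alpha> ^ n) * ennreal (b j k y)
      + c * (ennreal (b j k y) * indicator ((f ^^ k) ` ?T) y)) \<partial>lebesgue)"
    by (intro nn_integral_mono pt)
  also have "\<dots> = (\<integral>\<^sup>+y\<in>?E d. ennreal (b j k y) \<partial>lebesgue) +
      (\<integral>\<^sup>+y. ennreal (b j k (y - d)) * indicator (?E (- d)) (y - d) \<partial>lebesgue)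
      + (ennreal (D * \<alpha> ^ n) * (\<integral>\<^sup>+y. ennreal (b j k y) \<partial>lebesgue)
      + c * (\<integral>\<^sup>+y\<in>(f ^^ k) ` ?T. ennreal (b j k y) \<partial>lebesgue))"
    using mE1[of d] mE2 mT mb by (simp add: nn_integral_add nn_integral_cmult)
  also have "(\<integral>\<^sup>+y. ennreal (b j k (y - d)) * indicator (?E (- d)) (y - d) \<partial>lebesgue) =
      (\<integral>\<^sup>+y\<in>?E (- d). ennreal (b j k y) \<partial>lebesgue)"
    using nn_integral_real_affine_lebesgue[OF mE1[of "- d"], of 1 "- d"] by simp
  also have "(\<integral>\<^sup>+y\<in>(f ^^ k) ` ?T. ennreal (b j k y) \<partial>lebesgue) = nu ?T"
    by (rule change_variables(2)[OF j T])
  also have "(\<integral>\<^sup>+y. ennreal (b j k y) \<partial>lebesgue) = nu (P j)"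
    by (rule nn_integral_b[OF j])
  also have "(\<integral>\<^sup>+y\<in>?E d. ennreal (b j k y) \<partial>lebesgue) + (\<integral>\<^sup>+y\<in>?E (- d). ennreal (b j k y) \<partial>lebesgue)
      + (ennreal (D * \<alpha> ^ n) * nu (P j) + c * nu ?T) \<le>
      ennreal (W * measure lebesgue (P j) * (B ^ R j * \<bar>d\<bar>) powr t)
      + ennreal (W * measure lebesgue (P j) * (B ^ R j * \<bar>- d\<bar>) powr t)
      + (ennreal (D * \<alpha> ^ n) * ennreal (K * measure lebesgue (P j)) + c * nu ?T)"
    by (intro add_mono mult_left_mono edge_integral j t nu_P_le order_refl) simp_all
  also have "\<dots> = ennreal (2 * (W * measure lebesgue (P j) * (B ^ R j * \<bar>d\<bar>) powr t))
      + ennreal (D * \<alpha> ^ n * (K * measure lebesgue (P j)))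
      + (if R j - k \<le> n then ennreal D * nu ?T else 0)"
    using W_pos K_pos D_pos alpha
    by (auto simp: c_def add.assoc simp flip: ennreal_plus ennreal_mult)
  finally show ?thesis .
qed

section \<open>Summation over the tower\<close>

text \<open>Both \<open>p\<close> and \<open>level_sum\<close> vanish off \<open>J\<close>, so that
  sums over \<open>J\<close>, finite or infinite, become series over all naturals.\<close>

definition p :: "nat \<Rightarrow> real" where
  "p j = (if j \<in> J then measure lebesgue (P j) else 0)"

definition level_sum :: "nat \<Rightarrow> real \<Rightarrow> real" where
  "level_sum j y = (if j \<in> J then \<Sum>k<R j. b j k y else 0)"

abbreviation "\<Phi> \<equiv> srb_density f J P R \<phi>"

lemma p_nonneg: "0 \<le> p j" by (simp add: p_def)

lemma level_sum_nonneg: "0 \<le> level_sum j y"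
  by (auto simp: level_sum_def intro: sum_nonneg b_nonneg)

lemma level_sum_measurable [measurable]: "level_sum j \<in> borel_measurable lebesgue"
  unfolding level_sum_def using b_measurable by (cases "j \<in> J") auto

text \<open>Where the series diverges, both sides are 0: \<open>infsum\<close> and \<open>enn2real \<infinity>\<close> agree on their junk values.\<close>

lemma srb_density_eq: "\<Phi> y = enn2real (\<Sum>j. ennreal (level_sum j y))"
proof -
  have eq: "b j k y * indicator ((f ^^ k) ` P j) y = b j k y" for j k
    by (simp add: b_outside split: split_indicator)
  have "\<Phi> y = infsum (\<lambda>j. level_sum j y) UNIV"
    unfolding srb_density_def eq by (intro infsum_cong_neutral) (auto simp: level_sum_def)
  then show ?thesis using infsum_eq_enn2real level_sum_nonneg by simp
qed

lemma srb_density_measurable [measurable]: "\<Phi> \<in> borel_measurable lebesgue"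
  unfolding srb_density_eq[abs_def] by measurable

lemma srb_density_nonneg: "0 \<le> \<Phi> y"
  by (simp add: srb_density_eq)

text \<open>The elements are disjoint, so their exceptional parts add up to a single measure,
  without loss in the number of elements.\<close>

lemma sum_nu_le: 
  assumes "X \<in> sets borel"
  shows "(\<Sum>j. if j \<in> J then nu (P j \<inter> pull X) else 0) \<le> nu (pull X)"
proof -
  let ?A = "\<lambda>j. if j \<in> J then P j \<inter> pull X else {}"
  let ?M = "density (lebesgue_on L) (\<lambda>x. ennreal (\<phi> x))"
  have A: "?A j \<in> sets lebesgue \<and> ?A j \<subseteq> L" for j
    using borel_pull[OF assms] pull_subset P_sets by auto
  have "(\<Sum>j. if j \<in> J then nu (P j \<inter> pull X) else 0) = (\<Sum>j. emeasure ?M (?A j))"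
  proof (intro arg_cong[of _ _ suminf] ext)
    fix j
    show "(if j \<in> J then nu (P j \<inter> pull X) else 0) = emeasure ?M (?A j)"
      using A[of j] nu_eq_emeasure[of "P j \<inter> pull X"] by (cases "j \<in> J") simp_all
  qed
  also have "\<dots> = emeasure ?M (\<Union>j. ?A j)"
  proof (rule suminf_emeasure)
    have "?A j \<in> sets (lebesgue_on L)" for j
      using A[of j] L_sets(1) by (subst sets_restrict_space_iff) simp_all
    then show "range ?A \<subseteq> sets ?M" by (simp only: sets_density image_subset_iff) blast
    show "disjoint_family ?A" using disjoint_P by (auto simp: disjoint_family_on_def)
  qed
  also have "(\<Union>j. ?A j) = pull X" by (auto simp: pull_def)
  also have "emeasure ?M (pull X) = nu (pull X)"
    using borel_pull[OF assms] pull_subset by (intro nu_eq_emeasure[symmetric]) auto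
  finally show ?thesis by simp
qed

text \<open>Edge and regularity terms occur at all \<open>R j\<close> levels, but the exceptional
  term only where \<open>R j - k \<le> n\<close>, that is, at no more than \<open>n\<close> levels.
  A factor independent of \<open>j\<close> lets \<open>sum_nu_le\<close> handle the exceptional
  parts of all elements at once.\<close>

lemma level_sum_modulus:
  assumes j: "j \<in> J" and t: "0 < t" "t \<le> 1" and r: "B ^ n * \<bar>d\<bar> \<le> r"
  shows "(\<integral>\<^sup>+y. ennreal \<bar>level_sum j y - level_sum j (y - d)\<bar> \<partial>lebesgue) \<le>
    ennreal (real (R j) * (2 * (W * p j * (B ^ R j * \<bar>d\<bar>) powr t) + D * \<alpha> ^ n * (K * p j)))
    + of_nat n * (ennreal D * nu (P j \<inter> pull (slow r n)))"
proof -
  let ?x = "2 * (W * p j * (B ^ R j * \<bar>d\<bar>) powr t)" and ?y = "D * \<alpha> ^ n * (K * p j)"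
    and ?z = "ennreal D * nu (P j \<inter> pull (slow r n))"
  have pj: "p j = measure lebesgue (P j)" using j by (simp add: p_def)
  have nn: "0 \<le> ?x" "0 \<le> ?y" using W_pos D_pos K_pos alpha p_nonneg by simp_all
  have meas: "(\<lambda>y. ennreal \<bar>b j k y - b j k (y - d)\<bar>) \<in> borel_measurable lebesgue" if "k < R j" for k
    using b_measurable[OF j that] measurable_compose[OF measurable_translate b_measurable[OF j that]] by measurable
  have "(\<integral>\<^sup>+y. ennreal \<bar>level_sum j y - level_sum j (y - d)\<bar> \<partial>lebesgue) \<le>
      (\<integral>\<^sup>+y. (\<Sum>k<R j. ennreal \<bar>b j k y - b j k (y - d)\<bar>) \<partial>lebesgue)"
  proof (intro nn_integral_mono)
    fix y
    have "\<bar>level_sum j y - level_sum j (y - d)\<bar> \<le> (\<Sum>k<R j. \<bar>b j k y - b j k (y - d)\<bar>)"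
      using j by (simp add: level_sum_def flip: sum_subtractf)
    then show "ennreal \<bar>level_sum j y - level_sum j (y - d)\<bar> \<le> (\<Sum>k<R j. ennreal \<bar>b j k y - b j k (y - d)\<bar>)"
      by (simp add: ennreal_leI)
  qed
  also have "\<dots> = (\<Sum>k<R j. \<integral>\<^sup>+y. ennreal \<bar>b j k y - b j k (y - d)\<bar> \<partial>lebesgue)"
    using meas by (intro nn_integral_sum) auto
  also have "\<dots> \<le> (\<Sum>k<R j. ennreal ?x + ennreal ?y + (if R j - k \<le> n then ?z else 0))"
    unfolding pj by (intro sum_mono coeff_modulus j t r) simp
  also have "\<dots> = of_nat (R j) * ennreal (?x + ?y) + (\<Sum>k<R j. if R j - k \<le> n then ?z else 0)"
    using nn by (simp add: sum.distrib distrib_left)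
  also have "(\<Sum>k<R j. if R j - k \<le> n then ?z else 0) = of_nat (card {k\<in>{..<R j}. R j - k \<le> n}) * ?z"
    by (simp add: sum.inter_filter[symmetric])
  also have "\<dots> \<le> of_nat n * ?z"
  proof -
    have "{k\<in>{..<R j}. R j - k \<le> n} \<subseteq> {R j - n..<R j}" by auto
    then have "card {k\<in>{..<R j}. R j - k \<le> n} \<le> card {R j - n..<R j}" by (intro card_mono) auto
    then have "card {k\<in>{..<R j}. R j - k \<le> n} \<le> n" by simp
    then show ?thesis by (intro mult_right_mono) simp_all
  qed
  also have "of_nat (R j) * ennreal (?x + ?y) = ennreal (real (R j) * (?x + ?y))"
    using nn by (simp only: ennreal_of_nat_eq_real_of_nat ennreal_mult'')
  finally show ?thesis by (simp add: add_left_mono)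
qed

lemma nn_integral_level_sum_le:
  assumes "j \<in> J"
  shows "(\<integral>\<^sup>+y. ennreal (level_sum j y) \<partial>lebesgue) \<le> ennreal (real (R j) * (K * p j))"
proof -
  have "(\<integral>\<^sup>+y. ennreal (level_sum j y) \<partial>lebesgue) = (\<integral>\<^sup>+y. (\<Sum>k<R j. ennreal (b j k y)) \<partial>lebesgue)"
    using assms by (intro nn_integral_cong) (auto simp: level_sum_def b_nonneg intro!: sum_ennreal[symmetric])
  also have "\<dots> = (\<Sum>k<R j. nu (P j))"
    using b_measurable[OF assms] nn_integral_b[OF assms] by (subst nn_integral_sum) simp_all
  also have "\<dots> \<le> of_nat (R j) * ennreal (K * p j)"
    using nu_P_le[OF assms] assms by (simp add: p_def mult_left_mono)
  also have "\<dots> = ennreal (real (R j) * (K * p j))"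
    using K_pos p_nonneg by (simp add: ennreal_mult ennreal_of_nat_eq_real_of_nat)
  finally show ?thesis .
qed

text \<open>The entry 1 serves the bound by the length of the element, the other one the bound
  \<open>2 * r\<close> after \<open>measure_P_lower\<close>.\<close>

definition V where "V = max 1 (2 / measure lebesgue L)"

text \<open>Both bounds for the layer in \<open>P j\<close> are at most \<open>V\<close> times its
  length times 1 or \<open>B ^ R j * r\<close>. Interpolating with exponent \<open>t\<close>
  separates \<open>r powr t\<close> from a convergent series that does not depend on
  \<open>r\<close>.\<close>

lemma nu_near_cut_le:
  assumes t: "0 < t" "t \<le> 1" and r: "0 \<le> r"
    and sm: "summable (\<lambda>j. (B ^ R j) powr t * p j)"
  shows "nu (near_cut r) \<le> ennreal (K * V * (\<Sum>j. (B ^ R j) powr t * p j) * r powr t)"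
proof -
  have V: "1 \<le> V" by (simp add: V_def)
  have le: "min (2 * r) (measure lebesgue (P j)) \<le> V * r powr t * ((B ^ R j) powr t * p j)" if j: "j \<in> J" for j
  proof -
    let ?m = "measure lebesgue (P j)" and ?x = "B ^ R j * r"
    have "2 * r * measure lebesgue L \<le> 2 * r * (B ^ R j * ?m)"
      using measure_P_lower[OF j] r by (intro mult_left_mono) auto
    then have "2 * r \<le> 2 / measure lebesgue L * ?m * ?x"
      using L_pos by (simp add: field_simps)
    also have "\<dots> \<le> V * ?m * ?x"
      using r B_gt_1 by (intro mult_right_mono) (simp_all add: V_def)
    finally have "2 * r \<le> V * ?m * ?x" .
    moreover have "?m \<le> V * ?m * 1" using V mult_right_mono[of 1 V ?m] by simp
    ultimately have "min (2 * r) ?m \<le> V * ?m * min 1 ?x" by (auto simp: min_def)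
    also have "\<dots> \<le> V * ?m * ?x powr t"
      using V r B_gt_1 t by (intro mult_left_mono min_one_le_powr) auto
    also have "?x powr t = (B ^ R j) powr t * r powr t"
      using r B_gt_1 by (simp add: powr_mult)
    finally show ?thesis using j by (simp add: p_def mult_ac)
  qed
  have "nu (near_cut r) \<le> ennreal K * emeasure lebesgue (near_cut r)"
    using borel_near_cut by (intro nu_le) (auto simp: near_cut_def)
  also have "\<dots> \<le> ennreal K * (\<Sum>j. ennreal (V * r powr t * ((B ^ R j) powr t * p j)))"
  proof (intro mult_left_mono order_trans[OF emeasure_near_cut[OF r]] suminf_le summableI)
    fix j
    show "(if j \<in> J then ennreal (min (2 * r) (measure lebesgue (P j))) else 0)
        \<le> ennreal (V * r powr t * ((B ^ R j) powr t * p j))"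
      using le[of j] by (auto intro: ennreal_leI)
  qed simp
  also have "\<dots> = ennreal K * ennreal (V * r powr t * (\<Sum>j. (B ^ R j) powr t * p j))"
    using sm V p_nonneg by (subst suminf_ennreal2) (auto simp: suminf_mult intro!: summable_mult)
  also have "\<dots> = ennreal (K * V * (\<Sum>j. (B ^ R j) powr t * p j) * r powr t)"
    using K_pos V p_nonneg suminf_nonneg[OF sm] by (simp add: mult_ac flip: ennreal_mult)
  finally show ?thesis .
qed

text \<open>Finite integrals make the series finite almost everywhere, at \<open>y\<close> and by
  translation at \<open>y - d\<close>. There \<open>\<Phi>\<close> is the true sum and not the
  default 0, so the triangle inequality applies term by term.\<close>

lemma srb_modulus_le_sum:
  assumes fin: "(\<Sum>j. \<integral>\<^sup>+y. ennreal (level_sum j y) \<partial>lebesgue) < \<infinity>"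
  shows "(\<integral>\<^sup>+y. ennreal \<bar>\<Phi> y - \<Phi> (y - d)\<bar> \<partial>lebesgue) \<le>
    (\<Sum>j. \<integral>\<^sup>+y. ennreal \<bar>level_sum j y - level_sum j (y - d)\<bar> \<partial>lebesgue)"
proof -
  let ?u = "\<lambda>y. \<Sum>j. ennreal (level_sum j y)"
  have u[measurable]: "?u \<in> borel_measurable lebesgue" by measurable
  have int: "(\<integral>\<^sup>+y. ?u y \<partial>lebesgue) = (\<Sum>j. \<integral>\<^sup>+y. ennreal (level_sum j y) \<partial>lebesgue)"
    by (intro nn_integral_suminf) measurable
  have "(\<integral>\<^sup>+y. ?u (y - d) \<partial>lebesgue) = (\<integral>\<^sup>+y. ?u y \<partial>lebesgue)"
    using nn_integral_real_affine_lebesgue[OF u, of 1 "- d"] by simp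
  then have ae: "AE y in lebesgue. ?u y \<noteq> \<infinity>" "AE y in lebesgue. ?u (y - d) \<noteq> \<infinity>"
    using fin int nn_integral_PInf_AE[OF u] nn_integral_PInf_AE[OF measurable_compose[OF measurable_translate u]] by auto
  have meas: "(\<lambda>y. ennreal \<bar>level_sum j y - level_sum j (y - d)\<bar>) \<in> borel_measurable lebesgue" for j
    using measurable_compose[OF measurable_translate level_sum_measurable[of j]] by measurable
  have "AE y in lebesgue. ennreal \<bar>\<Phi> y - \<Phi> (y - d)\<bar> \<le>
      (\<Sum>j. ennreal \<bar>level_sum j y - level_sum j (y - d)\<bar>)"
    using ae
  proof eventually_elim
    case (elim y)
    have eq: "summable (\<lambda>j. level_sum j z) \<and> \<Phi> z = (\<Sum>j. level_sum j z)" if "?u z \<noteq> \<infinity>" for z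
    proof
      show sm: "summable (\<lambda>j. level_sum j z)"
        using that level_sum_nonneg by (intro summable_suminf_not_top) auto
      show "\<Phi> z = (\<Sum>j. level_sum j z)"
        using suminf_nonneg[OF sm] sm level_sum_nonneg by (simp add: srb_density_eq suminf_ennreal2)
    qed
    show ?case
      using eq[OF elim(1)] eq[OF elim(2)] ennreal_abs_suminf_diff_le level_sum_nonneg by simp
  qed
  then have "(\<integral>\<^sup>+y. ennreal \<bar>\<Phi> y - \<Phi> (y - d)\<bar> \<partial>lebesgue) \<le>
      (\<integral>\<^sup>+y. (\<Sum>j. ennreal \<bar>level_sum j y - level_sum j (y - d)\<bar>) \<partial>lebesgue)"
    by (rule nn_integral_mono_AE)
  also have "\<dots> = (\<Sum>j. \<integral>\<^sup>+y. ennreal \<bar>level_sum j y - level_sum j (y - d)\<bar> \<partial>lebesgue)"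
    by (intro nn_integral_suminf meas)
  finally show ?thesis .
qed

text \<open>Two exponents are at work. The edge terms are estimated with \<open>\<tau>\<close>
  directly, and summing them over the levels is possible because
  \<open>\<tau> * ln B < \<theta>\<close>. The neighbourhoods of the cuts use the larger
  \<open>t\<close>, half of which is lost in the choice of \<open>n\<close>.\<close>

lemma srb_density_modulus:
  fixes \<theta> \<tau> t :: real
  assumes summ: "(\<lambda>j. exp (\<theta> * real (R j)) * measure lebesgue (P j)) summable_on J"
    and t: "0 < t" "t \<le> 1" "t * ln B \<le> \<theta>"
    and \<tau>: "0 < \<tau>" "\<tau> < t / 2" "2 * \<tau> * ln B < ln (1 / \<alpha>)"
  shows "\<exists>C>0. (\<integral>\<^sup>+y. ennreal (\<Phi> y) \<partial>lebesgue) \<le> ennreal C \<and>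
    (\<forall>d. (\<integral>\<^sup>+y. ennreal \<bar>\<Phi> y - \<Phi> (y - d)\<bar> \<partial>lebesgue) \<le> ennreal (C * \<bar>d\<bar> powr \<tau>))"
proof -
  define q where "q j = exp (\<theta> * real (R j)) * p j" for j
  define Q where "Q = suminf q"
  have q_nonneg: "0 \<le> q j" for j by (simp add: q_def p_nonneg)
  have "q summable_on UNIV"
    using summ by (subst (asm) summable_on_cong_neutral[of UNIV J q]) (auto simp: q_def p_def)
  then have sq: "summable q" by (rule summable_on_imp_summable)
  have Q: "0 \<le> Q" unfolding Q_def using sq q_nonneg by (rule suminf_nonneg)
  have lnB: "0 < ln B" using B_gt_1 by simp
  have Bpow: "(B ^ m) powr s = exp (s * ln B * real m)" for s m
    using B_gt_1 by (simp add: powr_def ln_realpow mult_ac)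
  have pt: "(B ^ R j) powr t * p j \<le> q j" for j
    unfolding Bpow q_def using t by (intro mult_right_mono p_nonneg) (simp add: mult_right_mono)
  have st: "summable (\<lambda>j. (B ^ R j) powr t * p j)"
    using pt p_nonneg by (intro summable_comparison_test'[OF sq]) auto
  have Qt: "(\<Sum>j. (B ^ R j) powr t * p j) \<le> Q"
    unfolding Q_def by (intro suminf_le pt st sq)
  \<comment> \<open>The margin left in the exponential moment; it absorbs the number
    \<open>R j\<close> of levels.\<close>
  define e where "e = \<theta> - \<tau> * ln B"
  have e: "0 < e"
  proof -
    have "\<tau> * ln B < t * ln B" using \<tau> t lnB by (intro mult_strict_right_mono) auto
    then show ?thesis using t by (simp add: e_def)
  qed
  have RB: "real (R j) * ((B ^ R j) powr \<tau> * p j) \<le> q j / e" for j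
  proof -
    have "real (R j) * ((B ^ R j) powr \<tau> * p j) \<le> exp (e * real (R j)) / e * ((B ^ R j) powr \<tau> * p j)"
      using e by (intro mult_right_mono of_nat_le_exp) (simp_all add: p_nonneg)
    also have "\<dots> = exp (e * real (R j)) * exp (\<tau> * ln B * real (R j)) * p j / e"
      by (simp add: Bpow)
    also have "exp (e * real (R j)) * exp (\<tau> * ln B * real (R j)) = exp (\<theta> * real (R j))"
      by (simp add: e_def algebra_simps flip: exp_add)
    finally show ?thesis by (simp add: q_def)
  qed
  have Rp: "real (R j) * p j \<le> q j / e" for j
  proof -
    have "1 \<le> (B ^ R j) powr \<tau>" using B_gt_1 \<tau> by (intro ge_one_powr_ge_zero) auto
    then have "real (R j) * (1 * p j) \<le> real (R j) * ((B ^ R j) powr \<tau> * p j)"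
      by (intro mult_left_mono mult_right_mono p_nonneg) simp_all
    then show ?thesis using RB[of j] by simp
  qed
  have sum_q: "(\<Sum>j. ennreal (c * (q j / e))) = ennreal (c * (Q / e))" if "0 \<le> c" for c
  proof -
    have "(\<lambda>j. c * (q j / e)) sums (c * (Q / e))"
      using sq unfolding Q_def by (intro sums_mult sums_divide summable_sums)
    then show ?thesis using that q_nonneg e by (intro suminf_ennreal_eq) auto
  qed
  define N where "N = K * (Q / e)"
  have N: "0 \<le> N" using K_pos Q e by (simp add: N_def)
  have sum_N: "(\<Sum>j. \<integral>\<^sup>+y. ennreal (level_sum j y) \<partial>lebesgue) \<le> ennreal N"
  proof -
    have "(\<Sum>j. \<integral>\<^sup>+y. ennreal (level_sum j y) \<partial>lebesgue) \<le> (\<Sum>j. ennreal (K * (q j / e)))"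
    proof (intro suminf_le summableI)
      fix j
      show "(\<integral>\<^sup>+y. ennreal (level_sum j y) \<partial>lebesgue) \<le> ennreal (K * (q j / e))"
      proof (cases "j \<in> J")
        case True
        have "real (R j) * (K * p j) \<le> K * (q j / e)"
          using mult_left_mono[OF Rp[of j], of K] K_pos by (simp add: mult_ac)
        then show ?thesis
          using nn_integral_level_sum_le[OF True] by (meson ennreal_leI order_trans)
      qed (simp add: level_sum_def)
    qed
    then show ?thesis using sum_q[of K] K_pos by (simp add: N_def)
  qed
  then have fin: "(\<Sum>j. \<integral>\<^sup>+y. ennreal (level_sum j y) \<partial>lebesgue) < \<infinity>"
    by (simp add: order_le_less_trans)
  have int_\<Phi>: "(\<integral>\<^sup>+y. ennreal (\<Phi> y) \<partial>lebesgue) \<le> ennreal N"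
  proof -
    have "(\<integral>\<^sup>+y. ennreal (\<Phi> y) \<partial>lebesgue) \<le> (\<integral>\<^sup>+y. (\<Sum>j. ennreal (level_sum j y)) \<partial>lebesgue)"
      by (intro nn_integral_mono) (simp add: srb_density_eq ennreal_enn2real_if)
    also have "\<dots> = (\<Sum>j. \<integral>\<^sup>+y. ennreal (level_sum j y) \<partial>lebesgue)"
      by (intro nn_integral_suminf) measurable
    finally show ?thesis using sum_N by simp
  qed
  obtain c where c: "0 < c" "\<And>x. 0 < x \<Longrightarrow> x < 1 \<Longrightarrow>
      \<exists>n. \<alpha> ^ n \<le> c * x powr \<tau> \<and> real n * real (Suc n) * (B ^ n * x) powr t \<le> c * x powr \<tau>"
    using balanced_scale[OF alpha B_gt_1 \<tau>] by blast
  \<comment> \<open>Besides 1 for positivity, the summands serve, in order, shifts of size at least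
    1, the edge and regularity terms, and the exceptional points.\<close>
  define C where "C = 1 + 2 * N + (2 * W + D * K * c) * (Q / e) + D * (K * V * Q) * c"
  have V: "0 < V" by (simp add: V_def)
  have parts: "0 \<le> (2 * W + D * K * c) * (Q / e)" "0 \<le> D * (K * V * Q) * c"
    using W_pos D_pos K_pos V c Q e by simp_all
  have "(\<integral>\<^sup>+y. ennreal \<bar>\<Phi> y - \<Phi> (y - d)\<bar> \<partial>lebesgue) \<le> ennreal (C * \<bar>d\<bar> powr \<tau>)" for d
  proof -
    consider "d = 0" | "1 \<le> \<bar>d\<bar>" | "0 < \<bar>d\<bar>" "\<bar>d\<bar> < 1" by fastforce
    then show ?thesis
    proof cases
      case 1
      then show ?thesis by simp
    next
      case 2
      \<comment> \<open>For large shifts the triangle inequality and translation invariance suffice,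
        since \<open>\<bar>d\<bar> powr \<tau>\<close> is at least 1.\<close>
      have m1: "(\<lambda>y. ennreal (\<Phi> y)) \<in> borel_measurable lebesgue" by measurable
      have m2: "(\<lambda>y. ennreal (\<Phi> (y - d))) \<in> borel_measurable lebesgue"
        using measurable_compose[OF measurable_translate m1] .
      have "(\<integral>\<^sup>+y. ennreal \<bar>\<Phi> y - \<Phi> (y - d)\<bar> \<partial>lebesgue) \<le>
          (\<integral>\<^sup>+y. ennreal (\<Phi> y) + ennreal (\<Phi> (y - d)) \<partial>lebesgue)"
      proof (intro nn_integral_mono)
        fix y
        have "\<bar>\<Phi> y - \<Phi> (y - d)\<bar> \<le> \<Phi> y + \<Phi> (y - d)"
          using srb_density_nonneg[of y] srb_density_nonneg[of "y - d"] by simp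
        then show "ennreal \<bar>\<Phi> y - \<Phi> (y - d)\<bar> \<le> ennreal (\<Phi> y) + ennreal (\<Phi> (y - d))"
          using srb_density_nonneg by (simp add: ennreal_leI flip: ennreal_plus)
      qed
      also have "\<dots> = (\<integral>\<^sup>+y. ennreal (\<Phi> y) \<partial>lebesgue) + (\<integral>\<^sup>+y. ennreal (\<Phi> (y - d)) \<partial>lebesgue)"
        using m1 m2 by (rule nn_integral_add)
      also have "(\<integral>\<^sup>+y. ennreal (\<Phi> (y - d)) \<partial>lebesgue) = (\<integral>\<^sup>+y. ennreal (\<Phi> y) \<partial>lebesgue)"
        using nn_integral_real_affine_lebesgue[OF m1, of 1 "- d"] by simp
      also have "(\<integral>\<^sup>+y. ennreal (\<Phi> y) \<partial>lebesgue) + (\<integral>\<^sup>+y. ennreal (\<Phi> y) \<partial>lebesgue) \<le> ennreal N + ennreal N"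
        by (intro add_mono int_\<Phi>)
      also have "\<dots> = ennreal (2 * N)" using N by (simp flip: ennreal_plus)
      also have "\<dots> \<le> ennreal (C * \<bar>d\<bar> powr \<tau>)"
      proof (intro ennreal_leI)
        have "2 * N * 1 \<le> C * \<bar>d\<bar> powr \<tau>"
          using 2 \<tau> N parts by (intro mult_mono ge_one_powr_ge_zero) (simp_all add: C_def)
        then show "2 * N \<le> C * \<bar>d\<bar> powr \<tau>" by simp
      qed
      finally show ?thesis .
    next
      case 3
      let ?x = "\<bar>d\<bar> powr \<tau>"
      obtain n where n: "\<alpha> ^ n \<le> c * ?x"
          "real n * real (Suc n) * (B ^ n * \<bar>d\<bar>) powr t \<le> c * ?x"
        using c(2)[OF 3] by blast
      define r where "r = B ^ n * \<bar>d\<bar>"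
      have r0: "0 \<le> r" using B_gt_1 by (simp add: r_def)
      let ?z = "\<lambda>j. if j \<in> J then nu (P j \<inter> pull (slow r n)) else 0"
      have t1: "\<tau> \<le> 1" using \<tau> t by simp
      have "(\<integral>\<^sup>+y. ennreal \<bar>\<Phi> y - \<Phi> (y - d)\<bar> \<partial>lebesgue) \<le>
          (\<Sum>j. \<integral>\<^sup>+y. ennreal \<bar>level_sum j y - level_sum j (y - d)\<bar> \<partial>lebesgue)"
        by (rule srb_modulus_le_sum[OF fin])
      also have "\<dots> \<le> (\<Sum>j. ennreal ((2 * W + D * K * c) * ?x * (q j / e)) + of_nat n * ennreal D * ?z j)"
      proof (intro suminf_le summableI)
        fix j
        show "(\<integral>\<^sup>+y. ennreal \<bar>level_sum j y - level_sum j (y - d)\<bar> \<partial>lebesgue)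
            \<le> ennreal ((2 * W + D * K * c) * ?x * (q j / e)) + of_nat n * ennreal D * ?z j"
        proof (cases "j \<in> J")
          case True
          have "real (R j) * (2 * (W * p j * (B ^ R j * \<bar>d\<bar>) powr \<tau>) + D * \<alpha> ^ n * (K * p j))
              = 2 * W * ?x * (real (R j) * ((B ^ R j) powr \<tau> * p j)) + D * K * \<alpha> ^ n * (real (R j) * p j)"
            using B_gt_1 by (simp add: powr_mult algebra_simps)
          also have "\<dots> \<le> 2 * W * ?x * (q j / e) + D * K * (c * ?x) * (q j / e)"
            using RB[of j] Rp[of j] n W_pos D_pos K_pos c p_nonneg[of j] q_nonneg[of j]
            by (intro add_mono mult_mono mult_left_mono) auto
          also have "\<dots> = (2 * W + D * K * c) * ?x * (q j / e)" by (simp add: algebra_simps)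
          finally have "ennreal (real (R j) * (2 * (W * p j * (B ^ R j * \<bar>d\<bar>) powr \<tau>) + D * \<alpha> ^ n * (K * p j)))
              \<le> ennreal ((2 * W + D * K * c) * ?x * (q j / e))" by (rule ennreal_leI)
          \<comment> \<open>The edge exponent of \<open>level_sum_modulus\<close> is taken to be
            \<open>\<tau>\<close> and not \<open>t\<close>.\<close>
          then show ?thesis
            using level_sum_modulus[OF True \<tau>(1) t1, of n d r] True
            by (simp add: r_def mult.assoc) (meson add_right_mono order_trans)
        qed (simp add: level_sum_def)
      qed
      also have "\<dots> = (\<Sum>j. ennreal ((2 * W + D * K * c) * ?x * (q j / e))) + (\<Sum>j. of_nat n * ennreal D * ?z j)"
        by (intro suminf_add[symmetric] summableI)
      also have "(\<Sum>j. ennreal ((2 * W + D * K * c) * ?x * (q j / e))) = ennreal ((2 * W + D * K * c) * ?x * (Q / e))"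
        using W_pos D_pos K_pos c by (intro sum_q) simp
      also have "(\<Sum>j. of_nat n * ennreal D * ?z j) = of_nat n * ennreal D * (\<Sum>j. ?z j)"
        by (rule ennreal_suminf_cmult)
      also have "\<dots> \<le> of_nat n * ennreal D * (of_nat (Suc n) * ennreal (K * V * Q * r powr t))"
      proof (intro mult_left_mono)
        have "(\<Sum>j. ?z j) \<le> nu (pull (slow r n))" by (rule sum_nu_le[OF borel_slow])
        also have "\<dots> = nu (slow r n)" by (rule nu_pull[OF borel_slow slow_subset])
        also have "\<dots> \<le> of_nat (Suc n) * nu (near_cut r)" by (rule nu_slow)
        also have "\<dots> \<le> of_nat (Suc n) * ennreal (K * V * (\<Sum>j. (B ^ R j) powr t * p j) * r powr t)"
          by (intro mult_left_mono nu_near_cut_le t r0 st) simp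
        also have "\<dots> \<le> of_nat (Suc n) * ennreal (K * V * Q * r powr t)"
          using Qt K_pos V by (intro mult_left_mono ennreal_leI mult_right_mono) auto
        finally show "(\<Sum>j. ?z j) \<le> of_nat (Suc n) * ennreal (K * V * Q * r powr t)" .
      qed simp
      \<comment> \<open>The factor \<open>n\<close> comes from counting levels, the factor
        \<open>Suc n\<close> from counting returns.\<close>
      also have "of_nat n * ennreal D * (of_nat (Suc n) * ennreal (K * V * Q * r powr t))
          = ennreal (D * (K * V * Q) * (real n * real (Suc n) * r powr t))"
        using D_pos K_pos V Q
        by (simp add: ennreal_of_nat_eq_real_of_nat mult_ac del: of_nat_Suc flip: ennreal_mult)
      also have "\<dots> \<le> ennreal (D * (K * V * Q) * (c * ?x))"
        using n(2) D_pos K_pos V Q by (intro ennreal_leI mult_left_mono) (simp_all add: r_def)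
      also have "ennreal ((2 * W + D * K * c) * ?x * (Q / e)) + ennreal (D * (K * V * Q) * (c * ?x))
          = ennreal (((2 * W + D * K * c) * (Q / e) + D * (K * V * Q) * c) * ?x)"
        using W_pos D_pos K_pos V c Q e by (subst ennreal_plus[symmetric]) (simp_all add: algebra_simps)
      also have "\<dots> \<le> ennreal (C * ?x)"
        using N by (intro ennreal_leI mult_right_mono) (simp_all add: C_def)
      finally show ?thesis by (simp add: add_left_mono)
    qed
  qed
  moreover have "0 < C" "N \<le> C" using N parts by (simp_all add: C_def)
  ultimately show ?thesis
    using int_\<Phi> by (intro exI[of _ C]) (auto intro: order_trans ennreal_leI)
qed

end

section \<open>Choice of the exponent and conclusion\<close>

theorem theoremC1:
  fixes f \<phi> :: "real \<Rightarrow> real" and I L :: "real set"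
    and J :: "nat set" and P :: "nat \<Rightarrow> real set" and R :: "nat \<Rightarrow> nat"
    and B \<alpha> \<theta> \<tau> :: real
  assumes young: "young_map f I B L J P R"
    and phi: "return_invariant_density f L J P R \<phi>"
    and normalized: "prob_space (srb_measure f J P R \<phi>)"
    and theta: "0 < \<theta>" "(\<lambda>j. exp (\<theta> * real (R j)) * measure lebesgue (P j)) summable_on J"
    and alpha: "0 < \<alpha>" "\<alpha> < 1"
      "\<exists>C>0. \<forall>j\<in>J. \<forall>k<R j. \<forall>y\<in>(f ^^ k) ` P j. \<forall>y'\<in>(f ^^ k) ` P j.
         \<bar>tower_coeff f P \<phi> k j y / tower_coeff f P \<phi> k j y' - 1\<bar>
           \<le> C * enat_power \<alpha> (level_separation_time f J P R j k y y')"
    and coeff_size: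
      "\<exists>C>1. \<forall>j\<in>J. \<forall>k<R j. \<forall>y\<in>(f ^^ k) ` P j.
         inverse C * measure lebesgue (P j)
           \<le> tower_coeff f P \<phi> k j y * measure lebesgue ((f ^^ k) ` P j) \<and>
         tower_coeff f P \<phi> k j y * measure lebesgue ((f ^^ k) ` P j)
           \<le> C * measure lebesgue (P j)"
    and coeff_bound:
      "\<exists>C>0. \<forall>j\<in>J. \<forall>k<R j. \<forall>y\<in>(f ^^ k) ` P j.
         tower_coeff f P \<phi> k j y
           \<le> C * B ^ (R j - k) * measure lebesgue (P j) / measure lebesgue L"
    and tau: "0 < \<tau>"
      "\<tau> < min (ln (1 / \<alpha>) / (2 * ln B)) (1 / 4 * (min 1 (\<theta> / ln B)) ^ 3)"
  shows "(\<exists>C>0. \<forall>\<delta>::real.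
            (LINT y|lebesgue. \<bar>srb_density f J P R \<phi> y - srb_density f J P R \<phi> (y - \<delta>)\<bar>)
              \<le> C * \<bar>\<delta>\<bar> powr \<tau>) \<and>
         srb_density f J P R \<phi> \<in> besov_1_inf \<tau>"
proof -
  obtain D where D: "0 < D" "\<And>j k y y'. j \<in> J \<Longrightarrow> k < R j \<Longrightarrow> y \<in> (f ^^ k) ` P j \<Longrightarrow> y' \<in> (f ^^ k) ` P j \<Longrightarrow>
      \<bar>tower_coeff f P \<phi> k j y / tower_coeff f P \<phi> k j y' - 1\<bar>
        \<le> D * enat_power \<alpha> (level_separation_time f J P R j k y y')"
    using alpha(3) by blast
  obtain K where K: "1 < K" "\<And>j k y. j \<in> J \<Longrightarrow> k < R j \<Longrightarrow> y \<in> (f ^^ k) ` P j \<Longrightarrow>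
      inverse K * measure lebesgue (P j) \<le> tower_coeff f P \<phi> k j y * measure lebesgue ((f ^^ k) ` P j)"
     "\<And>j k y. j \<in> J \<Longrightarrow> k < R j \<Longrightarrow> y \<in> (f ^^ k) ` P j \<Longrightarrow>
      tower_coeff f P \<phi> k j y * measure lebesgue ((f ^^ k) ` P j) \<le> K * measure lebesgue (P j)"
    using coeff_size by blast
  obtain M where M: "0 < M" "\<And>j k y. j \<in> J \<Longrightarrow> k < R j \<Longrightarrow> y \<in> (f ^^ k) ` P j \<Longrightarrow>
      tower_coeff f P \<phi> k j y \<le> M * B ^ (R j - k) * measure lebesgue (P j) / measure lebesgue L"
    using coeff_bound by blast
  interpret tower_density f I B L J P R \<phi> \<alpha> D K M
  proof
    show "0 < K" using K(1) by simp
  qed (fact young phi alpha(1,2) D K(2,3) M)+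
  define t where "t = min 1 (\<theta> / ln B)"
  have lnB: "0 < ln B" using B_gt_1 by simp
  have t: "0 < t" "t \<le> 1" using theta(1) lnB by (simp_all add: t_def)
  have "t \<le> \<theta> / ln B" by (simp add: t_def)
  then have t\<theta>: "t * ln B \<le> \<theta>" using lnB by (simp add: field_simps)
  \<comment> \<open>As \<open>0 < t \<le> 1\<close>, the cubic condition gives
    \<open>\<tau> < t / 4\<close>, which is below the required \<open>t / 2\<close>.\<close>
  have "t ^ 3 \<le> t" using t power_decreasing[of 1 3 t] by simp
  then have t2: "\<tau> < t / 2" using tau(2) t by (simp add: t_def[symmetric])
  have \<tau>\<alpha>: "2 * \<tau> * ln B < ln (1 / \<alpha>)" using tau(2) lnB by (simp add: field_simps)
  obtain C where C: "0 < C" "(\<integral>\<^sup>+y. ennreal (\<Phi> y) \<partial>lebesgue) \<le> ennreal C"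
      "\<And>d. (\<integral>\<^sup>+y. ennreal \<bar>\<Phi> y - \<Phi> (y - d)\<bar> \<partial>lebesgue) \<le> ennreal (C * \<bar>d\<bar> powr \<tau>)"
    using srb_density_modulus[OF theta(2) t t\<theta> tau(1) t2 \<tau>\<alpha>] by blast
  have bound: "(LINT y|lebesgue. \<bar>\<Phi> y - \<Phi> (y - d)\<bar>) \<le> C * \<bar>d\<bar> powr \<tau>" for d
    using C by (intro integral_real_bounded) simp_all
  have "integrable lebesgue \<Phi>"
    using C(2) srb_density_nonneg
    by (intro integrableI_bounded srb_density_measurable) (auto simp: order_le_less_trans)
  moreover have "bdd_above ((\<lambda>d. \<bar>d\<bar> powr (- \<tau>) * (LINT y|lebesgue. \<bar>\<Phi> y - \<Phi> (y - d)\<bar>)) ` (UNIV - {0}))"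
  proof (rule bdd_aboveI2)
    fix d :: real assume "d \<in> UNIV - {0}"
    then have "\<bar>d\<bar> powr (- \<tau>) * (LINT y|lebesgue. \<bar>\<Phi> y - \<Phi> (y - d)\<bar>) \<le> \<bar>d\<bar> powr (- \<tau>) * (C * \<bar>d\<bar> powr \<tau>)"
      by (intro mult_left_mono bound) simp
    also have "\<dots> = C" using \<open>d \<in> UNIV - {0}\<close> by (simp add: powr_minus field_simps)
    finally show "\<bar>d\<bar> powr (- \<tau>) * (LINT y|lebesgue. \<bar>\<Phi> y - \<Phi> (y - d)\<bar>) \<le> C" .
  qed
  ultimately have "\<Phi> \<in> besov_1_inf \<tau>" by (simp add: besov_1_inf_def)
  then show ?thesis using bound C(1) by blast
qed

end
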